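(* Let $\mu$ be a shift-invariant $r$-step Markov probability measure on $A^{\mathbb Z}$, $r\ge 1$, where $A$ is a finite alphabet, and let $X$ be the support of $\mu$, where every letter of $A$ is assumed to occur in some element of $X$. Let $\varphi\colon A^*\to G$ be a (monoid) morphism onto a finite group $G$ with uniform probability measure $\nu$. If $X$ is $\varphi$-irreducible, then the product measure $\nu\times\mu$ is ergodic on the skew product $G\rtimes_\varphi X$. In particular, for every $K\subseteq G$, the language $L=\varphi^{-1}(K)$ has density $\delta_\mu(L)=|K|/|G|$.
   Context: $S$ denotes the shift map $S((x_n)_n)=(x_{n+1})_n$ on $A^{\mathbb Z}$. For $x\in A^{\mathbb Z}$ (or a finite word) and $i\le j$, $x_{[i,j)}=x_i x_{i+1}\cdots x_{j-1}$. A measure $\mu$ on $A^{\mathbb Z}$ is an $r$-step Markov measure if for every word $w=w_0\cdots w_{m-1}\in A^*$ of length $m\ge r$ with $\mu(x_{[0,m)}=w)\neq0$ and every $a\in A$, $\mu(x_m=a\mid x_{[0,m)}=w)=\mu(x_m=a\mid x_{[m-r,m)}=w_{[m-r,m)})$. The language $\mathcal L(X)$ is the set of all finite words $x_{[i,j)}$ with $x\in X$, $i\le j$ (including the empty word). $X$ is $\varphi$-irreducible if for all $u,v\in\mathcal L(X)$ there exists $w\in A^*$ such that $uwv\in\mathcal L(X)$ and $\varphi(uw)=1_G$. The skew product $G\rtimes_\varphi X$ is the dynamical system $(G\times X,T_\varphi)$, $G$ discrete, with $T_\varphi(g,x)=(g\varphi(x_0),Sx)$. The density of $L\subseteq A^*$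 is $\delta_\mu(L)=\lim_{n\to\infty}\frac1n\sum_{i=0}^{n-1}\mu(\{x\in X: x_{[0,i)}\in L\})$. *)

theory Defs
  imports "HOL-Probability.Probability" "HOL-Algebra.Group"
begin

abbreviation full_shift :: "(int \<Rightarrow> 'a) measure" where
  "full_shift \<equiv> PiM UNIV (\<lambda>_. count_space UNIV)"

definition shift_map :: "(int \<Rightarrow> 'a) \<Rightarrow> (int \<Rightarrow> 'a)" where
  "shift_map x = (\<lambda>n. x (n + 1))"

definition factor :: "(int \<Rightarrow> 'a) \<Rightarrow> int \<Rightarrow> int \<Rightarrow> 'a list" where
  "factor x i j = map x [i..j - 1]"

definition invariant_under :: "'b measure \<Rightarrow> ('b \<Rightarrow> 'b) \<Rightarrow> bool" where
  "invariant_under M T \<longleftrightarrow> T \<in> measurable M M \<and> distr M M T = M"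

definition ergodic :: "'b measure \<Rightarrow> ('b \<Rightarrow> 'b) \<Rightarrow> bool" where
  "ergodic M T \<longleftrightarrow> prob_space M \<and> invariant_under M T \<and>
     (\<forall>B\<in>sets M. T -` B \<inter> space M = B \<longrightarrow> measure M B = 0 \<or> measure M B = 1)"

text \<open>The topological support, for the product of the discrete topologies on the alphabet.\<close>

definition measure_support :: "(int \<Rightarrow> 'a) measure \<Rightarrow> (int \<Rightarrow> 'a) set" where
  "measure_support M =
     {x. \<forall>U. openin (product_topology (\<lambda>_. discrete_topology UNIV) UNIV) U \<and> x \<in> U
           \<longrightarrow> emeasure M U > 0}"

definition markov_measure :: "nat \<Rightarrow> (int \<Rightarrow> 'a) measure \<Rightarrow> bool" where
  "markov_measure r M \<longleftrightarrow>
     (\<forall>w a m. m = length w \<and> m \<ge> r \<and> \<P>(x in M. factor x 0 (int m) = w) \<noteq> 0 \<longrightarrow>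
        \<P>(x in M. x (int m) = a \<bar> factor x 0 (int m) = w) =
        \<P>(x in M. x (int m) = a \<bar> factor x (int m - int r) (int m) = drop (m - r) w))"

definition language :: "(int \<Rightarrow> 'a) set \<Rightarrow> 'a list set" where
  "language X = {factor x i j | x i j. x \<in> X \<and> i \<le> j}"

definition word_monoid :: "'a list monoid" where
  "word_monoid = \<lparr>carrier = UNIV, mult = (@), one = []\<rparr>"

definition morphism_irreducible ::
    "('g, 'b) monoid_scheme \<Rightarrow> ('a list \<Rightarrow> 'g) \<Rightarrow> (int \<Rightarrow> 'a) set \<Rightarrow> bool" where
  "morphism_irreducible G \<phi> X \<longleftrightarrow>
     (\<forall>u\<in>language X. \<forall>v\<in>language X. \<exists>w. u @ w @ v \<in> language X \<and> \<phi> (u @ w) = \<one>\<^bsub>G\<^esub>)"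

definition skew_map ::
    "('g, 'b) monoid_scheme \<Rightarrow> ('a list \<Rightarrow> 'g) \<Rightarrow> 'g \<times> (int \<Rightarrow> 'a) \<Rightarrow> 'g \<times> (int \<Rightarrow> 'a)" where
  "skew_map G \<phi> = (\<lambda>(g, x). (g \<otimes>\<^bsub>G\<^esub> \<phi> [x 0], shift_map x))"

definition skew_measure ::
    "('g, 'b) monoid_scheme \<Rightarrow> (int \<Rightarrow> 'a) measure \<Rightarrow> ('g \<times> (int \<Rightarrow> 'a)) measure" where
  "skew_measure G M =
     uniform_count_measure (carrier G) \<Otimes>\<^sub>M restrict_space M (measure_support M)"

text \<open>\<^term>\<open>has_language_density M L d\<close> asserts both that the limit defining the density of
  \<^term>\<open>L\<close> exists and that its value is \<^term>\<open>d\<close>.\<close>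

definition has_language_density ::
    "(int \<Rightarrow> 'a) measure \<Rightarrow> 'a list set \<Rightarrow> real \<Rightarrow> bool" where
  "has_language_density M L d \<longleftrightarrow>
     (\<lambda>n. (1 / real n) * (\<Sum>i<n. measure M {x \<in> measure_support M. factor x 0 (int i) \<in> L}))
       \<longlonglongrightarrow> d"

end

theory Submission
  imports Defs
begin

text \<open>Let \<open>T\<close> be the skew product map and \<open>m\<close> the product measure. For \<open>n \<ge> max r 1\<close>, the cylinders
  \<open>{g} \<times> [s]\<close> with \<open>length s = n\<close> form a Markov partition for \<open>T\<close>, and \<open>\<phi>\<close>-irreducibility together
  with surjectivity of \<open>\<phi>\<close> makes the associated finite Markov chain irreducible. By an approximate
  maximum principle for this chain, the Cesaro averages of \<open>m(C \<inter> T\<^sup>-\<^sup>n D)\<close> converge to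
  \<open>m(C) m(D)\<close> when \<open>C\<close> and \<open>D\<close> are cells. Every set determined by the coordinates in \<open>[-k, k)\<close> is pulled
  back by \<open>T\<^sup>k\<close> to a union of cells, so the convergence holds on a generator, and by a \<open>\<pi>\<close>-\<open>\<lambda>\<close>
  argument in each variable for all measurable \<open>C\<close>, \<open>D\<close>. Taking \<open>C = D\<close> invariant gives ergodicity;
  taking \<open>C = {1} \<times> X\<close> and \<open>D = K \<times> X\<close> gives the density.\<close>

section \<open>Cesaro convergence\<close>

definition cesaro_mean :: "(nat \<Rightarrow> real) \<Rightarrow> nat \<Rightarrow> real" where
  "cesaro_mean a n = (\<Sum>i<n. a i) / real n"

definition cesaro_tendsto :: "(nat \<Rightarrow> real) \<Rightarrow> real \<Rightarrow> bool" where
  "cesaro_tendsto a l \<longleftrightarrow> cesaro_mean a \<longlonglongrightarrow> l"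

lemma cesaro_mean_const: "0 < n \<Longrightarrow> cesaro_mean (\<lambda>_. c) n = c"
  by (simp add: cesaro_mean_def)

lemma cesaro_mean_diff: "cesaro_mean (\<lambda>i. a i - b i) n = cesaro_mean a n - cesaro_mean b n"
  by (simp add: cesaro_mean_def sum_subtractf diff_divide_distrib)

lemma cesaro_mean_cmult: "cesaro_mean (\<lambda>i. c * a i) n = c * cesaro_mean a n"
  by (simp add: cesaro_mean_def flip: sum_distrib_left)

lemma cesaro_mean_sum: "cesaro_mean (\<lambda>i. \<Sum>k\<in>I. a k i) n = (\<Sum>k\<in>I. cesaro_mean (a k) n)"
  unfolding cesaro_mean_def by (subst sum.swap) (simp add: sum_divide_distrib)

lemma cesaro_mean_suminf:
  "(\<And>i. summable (\<lambda>k. a k i)) \<Longrightarrow> cesaro_mean (\<lambda>i. \<Sum>k. a k i) n = (\<Sum>k. cesaro_mean (a k) n)"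
  by (simp add: cesaro_mean_def suminf_divide summable_sum flip: suminf_sum)

lemma cesaro_mean_Suc: "cesaro_mean (\<lambda>i. a (Suc i)) n = cesaro_mean a n + (a n - a 0) / real n"
  using sum_lessThan_telescope[of a n]
  by (simp add: cesaro_mean_def sum_subtractf flip: add_divide_distrib)

lemma abs_cesaro_mean_le:
  assumes "\<And>i. \<bar>a i\<bar> \<le> B"
  shows "\<bar>cesaro_mean a n\<bar> \<le> B"
proof (cases "n = 0")
  case True
  then show ?thesis
    using assms[of 0] by (simp add: cesaro_mean_def)
next
  case False
  have "\<bar>\<Sum>i<n. a i\<bar> \<le> real n * B"
    using sum_norm_bound[of "{..<n}" a B] assms by simp
  then show ?thesis
    using False by (simp add: cesaro_mean_def field_simps)
qed

lemma cesaro_tendsto_const: "cesaro_tendsto (\<lambda>_. c) c"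
  unfolding cesaro_tendsto_def
  by (rule tendsto_eventually, rule eventually_mono[OF eventually_gt_at_top[of 0]])
     (rule cesaro_mean_const)

lemma cesaro_tendsto_unique: "cesaro_tendsto a l \<Longrightarrow> cesaro_tendsto a l' \<Longrightarrow> l = l'"
  unfolding cesaro_tendsto_def by (rule LIMSEQ_unique)

lemma cesaro_tendsto_diff:
  "cesaro_tendsto a l \<Longrightarrow> cesaro_tendsto b l' \<Longrightarrow> cesaro_tendsto (\<lambda>n. a n - b n) (l - l')"
  unfolding cesaro_tendsto_def cesaro_mean_diff by (rule tendsto_diff)

lemma cesaro_tendsto_cmult: "cesaro_tendsto a l \<Longrightarrow> cesaro_tendsto (\<lambda>n. c * a n) (c * l)"
  unfolding cesaro_tendsto_def cesaro_mean_cmult by (rule tendsto_mult_left)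

lemma cesaro_tendsto_sum:
  "(\<And>k. k \<in> I \<Longrightarrow> cesaro_tendsto (a k) (l k)) \<Longrightarrow>
    cesaro_tendsto (\<lambda>n. \<Sum>k\<in>I. a k n) (\<Sum>k\<in>I. l k)"
  unfolding cesaro_tendsto_def cesaro_mean_sum by (rule tendsto_sum)

lemma cesaro_tendsto_suminf:
  fixes a :: "nat \<Rightarrow> nat \<Rightarrow> real"
  assumes lim: "\<And>k. cesaro_tendsto (a k) (l k)"
    and bound: "\<And>k n. \<bar>a k n\<bar> \<le> B k" and "summable B"
  shows "cesaro_tendsto (\<lambda>n. \<Sum>k. a k n) (\<Sum>k. l k)"
proof -
  have "summable (\<lambda>k. a k i)" for i
    using bound by (intro summable_comparison_test'[OF \<open>summable B\<close>, of 0]) simp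
  then have "cesaro_mean (\<lambda>i. \<Sum>k. a k i) = (\<lambda>n. \<Sum>k. cesaro_mean (a k) n)"
    by (intro ext cesaro_mean_suminf)
  moreover have "(\<lambda>n. \<Sum>k. cesaro_mean (a k) n) \<longlonglongrightarrow> (\<Sum>k. l k)"
    using tannerys_theorem[of "\<lambda>k. cesaro_mean (a k)" l sequentially B] lim \<open>summable B\<close>
    by (simp add: cesaro_tendsto_def abs_cesaro_mean_le[OF bound] case_prod_unfold)
  ultimately show ?thesis
    by (simp add: cesaro_tendsto_def)
qed

section \<open>Finite irreducible Markov chains\<close>

locale irreducible_markov_chain =
  fixes Q :: "'q set" and p :: "'q \<Rightarrow> 'q \<Rightarrow> real"
  assumes finite_states: "finite Q"
    and transition_nonneg: "q \<in> Q \<Longrightarrow> q' \<in> Q \<Longrightarrow> 0 \<le> p q q'"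
    and transition_sum: "q \<in> Q \<Longrightarrow> (\<Sum>q'\<in>Q. p q q') = 1"
    and reachable: "q \<in> Q \<Longrightarrow> q' \<in> Q \<Longrightarrow> (q, q') \<in> {(s, t). s \<in> Q \<and> t \<in> Q \<and> 0 < p s t}\<^sup>*"
begin

definition nonneg_superharmonic_upto :: "real \<Rightarrow> ('q \<Rightarrow> real) \<Rightarrow> bool" where
  "nonneg_superharmonic_upto \<epsilon> d \<longleftrightarrow>
     0 \<le> \<epsilon> \<and> (\<forall>q\<in>Q. 0 \<le> d q \<and> (\<Sum>q'\<in>Q. p q q' * d q') \<le> d q + \<epsilon>)"

definition harmonic_upto :: "real \<Rightarrow> ('q \<Rightarrow> real) \<Rightarrow> bool" where
  "harmonic_upto \<epsilon> a \<longleftrightarrow> (\<forall>q\<in>Q. \<bar>(\<Sum>q'\<in>Q. p q q' * a q') - a q\<bar> \<le> \<epsilon>)"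

lemma harnack_inequality:
  assumes "q \<in> Q" "q' \<in> Q"
  shows "\<exists>K. \<forall>\<epsilon> d. nonneg_superharmonic_upto \<epsilon> d \<longrightarrow> d q' \<le> K * (d q + \<epsilon>)"
  using reachable[OF assms]
proof (induction rule: rtrancl_induct)
  case base
  show ?case
    by (intro exI[of _ 1]) (simp add: nonneg_superharmonic_upto_def)
next
  case (step s t)
  then obtain K where K: "\<And>\<epsilon> d. nonneg_superharmonic_upto \<epsilon> d \<Longrightarrow> d s \<le> K * (d q + \<epsilon>)"
    by blast
  have st: "s \<in> Q" "t \<in> Q" "0 < p s t"
    using step.hyps by auto
  have "d t \<le> (K + 1) / p s t * (d q + \<epsilon>)" if d: "nonneg_superharmonic_upto \<epsilon> d" for \<epsilon> d
  proof -
    have nonneg: "\<And>s. s \<in> Q \<Longrightarrow> 0 \<le> d s"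
      using d by (simp add: nonneg_superharmonic_upto_def)
    have "p s t * d t \<le> (\<Sum>q'\<in>Q. p s q' * d q')"
      using st nonneg finite_states transition_nonneg
      by (intro member_le_sum[of t Q "\<lambda>q'. p s q' * d q'"]) auto
    also have "\<dots> \<le> d s + \<epsilon>"
      using d st by (simp add: nonneg_superharmonic_upto_def)
    also have "\<dots> \<le> (K + 1) * (d q + \<epsilon>)"
      using K[OF d] nonneg[OF assms(1)] by (simp add: algebra_simps)
    finally show ?thesis
      using st by (simp add: field_simps)
  qed
  then show ?case
    by blast
qed

lemma harmonic_upto_oscillation:
  "\<exists>K. \<forall>\<epsilon> a. harmonic_upto \<epsilon> a \<longrightarrow> (\<forall>q\<in>Q. \<forall>q'\<in>Q. \<bar>a q - a q'\<bar> \<le> K * \<epsilon>)"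
proof -
  obtain H where H: "\<And>q q' \<epsilon> d. q \<in> Q \<Longrightarrow> q' \<in> Q \<Longrightarrow>
      nonneg_superharmonic_upto \<epsilon> d \<Longrightarrow> d q' \<le> H q q' * (d q + \<epsilon>)"
    using harnack_inequality by metis
  define K where "K = (\<Sum>(q, q')\<in>Q \<times> Q. \<bar>H q q'\<bar>)"
  have "\<bar>a q - a q'\<bar> \<le> K * \<epsilon>" if a: "harmonic_upto \<epsilon> a" and q: "q \<in> Q" "q' \<in> Q" for \<epsilon> a q q'
  proof -
    have "0 \<le> \<epsilon>"
      using a q by (force simp: harmonic_upto_def)
    obtain m where m: "m \<in> Q" "a m = Max (a ` Q)"
      using finite_states q(1) by (metis obtains_MAX empty_iff)
    then have le_max: "a s \<le> a m" if "s \<in> Q" for s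
      using finite_states that by simp
    have "(\<Sum>s'\<in>Q. p s s' * (a m - a s')) = a m - (\<Sum>s'\<in>Q. p s s' * a s')" if "s \<in> Q" for s
      using transition_sum[OF that]
      by (simp add: right_diff_distrib sum_subtractf flip: sum_distrib_right)
    then have superharmonic: "nonneg_superharmonic_upto \<epsilon> (\<lambda>s. a m - a s)"
      using a le_max \<open>0 \<le> \<epsilon>\<close> by (force simp: nonneg_superharmonic_upto_def harmonic_upto_def)
    have deficit_le: "a m - a s \<le> K * \<epsilon>" if "s \<in> Q" for s
    proof -
      have "a m - a s \<le> H m s * \<epsilon>"
        using H[OF m(1) that superharmonic] by simp
      also have "\<dots> \<le> K * \<epsilon>"
        using member_le_sum[of "(m, s)" "Q \<times> Q" "\<lambda>(q, q'). \<bar>H q q'\<bar>"]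
          m(1) that finite_states \<open>0 \<le> \<epsilon>\<close>
        by (intro mult_right_mono) (auto simp: K_def)
      finally show ?thesis .
    qed
    show ?thesis
      using q[THEN deficit_le] q[THEN le_max] by linarith
  qed
  then show ?thesis
    by blast
qed

lemma harmonic_upto_cesaro_mean:
  assumes step: "\<And>n q. q \<in> Q \<Longrightarrow> f (Suc n) q = (\<Sum>q'\<in>Q. p q q' * f n q')"
    and bound: "\<And>n q. q \<in> Q \<Longrightarrow> \<bar>f n q\<bar> \<le> B"
  shows "harmonic_upto (2 * B / real n) (\<lambda>q. cesaro_mean (\<lambda>i. f i q) n)"
  unfolding harmonic_upto_def
proof
  fix q assume q: "q \<in> Q"
  have "(\<Sum>q'\<in>Q. p q q' * cesaro_mean (\<lambda>i. f i q') n) = cesaro_mean (\<lambda>i. f (Suc i) q) n"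
    by (simp add: step[OF q] cesaro_mean_sum cesaro_mean_cmult)
  also have "\<dots> = cesaro_mean (\<lambda>i. f i q) n + (f n q - f 0 q) / real n"
    by (rule cesaro_mean_Suc)
  finally show "\<bar>(\<Sum>q'\<in>Q. p q q' * cesaro_mean (\<lambda>i. f i q') n) - cesaro_mean (\<lambda>i. f i q) n\<bar>
      \<le> 2 * B / real n"
    using bound[OF q, of n] bound[OF q, of 0] by (simp add: divide_right_mono)
qed

text \<open>The Cesaro means of \<open>f\<close> are harmonic up to \<open>O(1/n)\<close>, hence constant on \<open>Q\<close> up to \<open>O(1/n)\<close>,
  and the constant can only be their conserved average.\<close>

lemma cesaro_tendsto_conserved_average:
  assumes step: "\<And>n q. q \<in> Q \<Longrightarrow> f (Suc n) q = (\<Sum>q'\<in>Q. p q q' * f n q')"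
    and bound: "\<And>n q. q \<in> Q \<Longrightarrow> \<bar>f n q\<bar> \<le> B"
    and weights: "(\<Sum>q\<in>Q. \<pi> q) = 1"
    and conserved: "\<And>n. (\<Sum>q\<in>Q. \<pi> q * f n q) = c"
    and q: "q \<in> Q"
  shows "cesaro_tendsto (\<lambda>n. f n q) c"
proof -
  define a where "a n q = cesaro_mean (\<lambda>i. f i q) n" for n q
  have harmonic: "harmonic_upto (2 * B / real n) (a n)" for n
    unfolding a_def using step bound by (rule harmonic_upto_cesaro_mean)
  obtain K where K: "\<And>\<epsilon> a q q'. harmonic_upto \<epsilon> a \<Longrightarrow> q \<in> Q \<Longrightarrow> q' \<in> Q \<Longrightarrow> \<bar>a q - a q'\<bar> \<le> K * \<epsilon>"
    using harmonic_upto_oscillation by blast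
  have "\<bar>a n q - c\<bar> \<le> (\<Sum>s\<in>Q. \<bar>\<pi> s\<bar>) * (K * (2 * B / real n))" if n: "0 < n" for n
  proof -
    have "(\<Sum>s\<in>Q. \<pi> s * a n s) = cesaro_mean (\<lambda>i. \<Sum>s\<in>Q. \<pi> s * f i s) n"
      by (simp add: a_def cesaro_mean_sum cesaro_mean_cmult)
    then have "a n q - c = (\<Sum>s\<in>Q. \<pi> s * (a n q - a n s))"
      using weights
      by (simp add: conserved cesaro_mean_const[OF n] right_diff_distrib sum_subtractf
          flip: sum_distrib_right)
    also have "\<bar>\<dots>\<bar> \<le> (\<Sum>s\<in>Q. \<bar>\<pi> s\<bar> * (K * (2 * B / real n)))"
      using K[OF harmonic q]
      by (intro order_trans[OF sum_abs] sum_mono) (metis abs_ge_zero abs_mult mult_left_mono)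
    finally show ?thesis
      by (simp only: sum_distrib_right)
  qed
  then have "\<forall>\<^sub>F n in sequentially. norm (a n q - c) \<le> (\<Sum>s\<in>Q. \<bar>\<pi> s\<bar>) * (K * (2 * B / real n))"
    by (intro eventually_mono[OF eventually_gt_at_top[of 0]]) simp
  moreover have "(\<lambda>n. (\<Sum>s\<in>Q. \<bar>\<pi> s\<bar>) * (K * (2 * B / real n))) \<longlonglongrightarrow> 0"
    by (intro tendsto_mult_right_zero lim_const_over_n)
  ultimately have "(\<lambda>n. a n q - c) \<longlonglongrightarrow> 0"
    by (rule Lim_null_comparison)
  then show ?thesis
    by (simp add: cesaro_tendsto_def a_def LIM_zero_iff)
qed

end

section \<open>Independence on average\<close>

lemma (in finite_measure) measure_eq_sum_Int:
  assumes "finite I" "disjoint_family_on C I" "\<And>i. i \<in> I \<Longrightarrow> C i \<inter> E \<in> sets M" "E \<subseteq> (\<Union>i\<in>I. C i)"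
  shows "measure M E = (\<Sum>i\<in>I. measure M (C i \<inter> E))"
proof -
  have "E = (\<Union>i\<in>I. C i \<inter> E)"
    using assms(4) by blast
  also have "measure M \<dots> = (\<Sum>i\<in>I. measure M (C i \<inter> E))"
    using assms(1-3) by (intro finite_measure_finite_Union) (auto simp: disjoint_family_on_def)
  finally show ?thesis .
qed

lemma cesaro_tendsto_measure_UN:
  fixes N :: "nat \<Rightarrow> 'b measure" and F :: "nat \<Rightarrow> 'b set"
  assumes M: "finite_measure M"
    and N: "\<And>n. finite_measure (N n)" "\<And>n. sets (N n) = sets M"
    and dominated: "\<And>n E. E \<in> sets M \<Longrightarrow> measure (N n) E \<le> measure M E"
    and F: "range F \<subseteq> sets M" "disjoint_family F"
    and lim: "\<And>i. cesaro_tendsto (\<lambda>n. measure (N n) (F i)) (c * measure M (F i))"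
  shows "cesaro_tendsto (\<lambda>n. measure (N n) (\<Union>i. F i)) (c * measure M (\<Union>i. F i))"
proof -
  have sums_N: "(\<lambda>i. measure (N n) (F i)) sums measure (N n) (\<Union>i. F i)" for n
    using finite_measure.finite_measure_UNION[OF N(1) _ F(2)] F(1) by (simp add: N(2))
  have sums_M: "(\<lambda>i. measure M (F i)) sums measure M (\<Union>i. F i)"
    by (rule finite_measure.finite_measure_UNION[OF M F])
  have "cesaro_tendsto (\<lambda>n. \<Sum>i. measure (N n) (F i)) (\<Sum>i. c * measure M (F i))"
    using dominated[OF subsetD[OF F(1) rangeI]]
    by (intro cesaro_tendsto_suminf[OF lim _ sums_summable[OF sums_M]]) simp
  then show ?thesis
    using sums_unique[OF sums_N] sums_unique[OF sums_mult[OF sums_M, of c]] by simp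
qed

lemma cesaro_tendsto_measure_generator:
  fixes N :: "nat \<Rightarrow> 'b measure"
  assumes M: "finite_measure M"
    and N: "\<And>n. finite_measure (N n)" "\<And>n. sets (N n) = sets M"
    and dominated: "\<And>n E. E \<in> sets M \<Longrightarrow> measure (N n) E \<le> measure M E"
    and gen: "Int_stable A" "A \<subseteq> Pow (space M)" "sets M = sigma_sets (space M) A"
    and space: "cesaro_tendsto (\<lambda>n. measure (N n) (space M)) (c * measure M (space M))"
    and basic: "\<And>D. D \<in> A \<Longrightarrow> cesaro_tendsto (\<lambda>n. measure (N n) D) (c * measure M D)"
    and D: "D \<in> sets M"
  shows "cesaro_tendsto (\<lambda>n. measure (N n) D) (c * measure M D)"
  using gen(1,2) D[unfolded gen(3)]
proof (induction rule: sigma_sets_induct_disjoint)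
  case (basic D)
  then show ?case
    by (rule assms)
next
  case empty
  show ?case
    by (simp add: cesaro_tendsto_const)
next
  case (compl D)
  then have D: "D \<in> sets M"
    using gen by simp
  then have "measure (N n) (space M - D) = measure (N n) (space M) - measure (N n) D" for n
    using finite_measure.finite_measure_compl[OF N(1)] sets_eq_imp_space_eq[OF N(2)] by (simp add: N(2))
  then show ?case
    using cesaro_tendsto_diff[OF space compl.IH]
    by (simp add: finite_measure.finite_measure_compl[OF M D] right_diff_distrib)
next
  case (union F)
  then have "range F \<subseteq> sets M"
    using gen by simp
  then show ?case
    using union by (intro cesaro_tendsto_measure_UN[OF M N dominated])
qed

definition cesaro_independent :: "'b measure \<Rightarrow> ('b \<Rightarrow> 'b) \<Rightarrow> 'b set \<Rightarrow> 'b set \<Rightarrow> bool" where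
  "cesaro_independent M T C D \<longleftrightarrow>
     cesaro_tendsto (\<lambda>n. measure M (C \<inter> (T ^^ n) -` D)) (measure M C * measure M D)"

locale probability_preserving = prob_space M for M :: "'b measure" +
  fixes T :: "'b \<Rightarrow> 'b"
  assumes invariant: "invariant_under M T"
begin

lemma measurable_funpow: "(T ^^ n) \<in> measurable M M"
  using invariant by (induction n) (auto simp: id_def invariant_under_def intro: measurable_comp)

lemma funpow_in_space: "z \<in> space M \<Longrightarrow> (T ^^ n) z \<in> space M"
  using measurable_space[OF measurable_funpow] .

lemma in_space: "z \<in> space M \<Longrightarrow> T z \<in> space M"
  using funpow_in_space[of z 1] by simp

lemma sets_Int_vimage_funpow:
  assumes "C \<in> sets M" "D \<in> sets M"
  shows "C \<inter> (T ^^ n) -` D \<in> sets M"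
proof -
  have "C \<inter> (T ^^ n) -` D = C \<inter> ((T ^^ n) -` D \<inter> space M)"
    using sets.sets_into_space[OF assms(1)] by auto
  then show ?thesis
    using assms measurable_sets[OF measurable_funpow assms(2)] by auto
qed

lemma distr_funpow: "distr M M (T ^^ n) = M"
proof (induction n)
  case 0
  show ?case
    by (simp add: id_def)
next
  case (Suc n)
  then show ?case
    using invariant distr_distr[of T M M "T ^^ n" M] measurable_funpow
    by (simp add: invariant_under_def comp_def)
qed

lemma measure_vimage_funpow: "E \<in> sets M \<Longrightarrow> measure M ((T ^^ n) -` E \<inter> space M) = measure M E"
  using measure_distr[OF measurable_funpow, of E n] by (simp add: distr_funpow)

lemma measure_vimage: "E \<in> sets M \<Longrightarrow> measure M (T -` E \<inter> space M) = measure M E"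
  using measure_vimage_funpow[of E 1] by simp

lemma cesaro_independent_vimage_funpow:
  assumes "C \<in> sets M" "D \<in> sets M"
    and "cesaro_independent M T ((T ^^ k) -` C \<inter> space M) ((T ^^ k) -` D \<inter> space M)"
  shows "cesaro_independent M T C D"
proof -
  have "measure M (((T ^^ k) -` C \<inter> space M) \<inter> (T ^^ n) -` ((T ^^ k) -` D \<inter> space M))
      = measure M (C \<inter> (T ^^ n) -` D)" for n
  proof -
    have "(T ^^ k) ((T ^^ n) z) = (T ^^ n) ((T ^^ k) z)" for z
      by (metis add.commute comp_apply funpow_add)
    then have "((T ^^ k) -` C \<inter> space M) \<inter> (T ^^ n) -` ((T ^^ k) -` D \<inter> space M)
        = (T ^^ k) -` (C \<inter> (T ^^ n) -` D) \<inter> space M"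
      using funpow_in_space by auto
    then show ?thesis
      by (simp only: measure_vimage_funpow sets_Int_vimage_funpow assms(1,2))
  qed
  then show ?thesis
    using assms by (simp add: cesaro_independent_def measure_vimage_funpow)
qed

lemma cesaro_independent_UN:
  assumes "finite I" "finite J" and disj: "disjoint_family_on C I" "disjoint_family_on D J"
    and sets: "\<And>i. i \<in> I \<Longrightarrow> C i \<in> sets M" "\<And>j. j \<in> J \<Longrightarrow> D j \<in> sets M"
    and indep: "\<And>i j. i \<in> I \<Longrightarrow> j \<in> J \<Longrightarrow> cesaro_independent M T (C i) (D j)"
  shows "cesaro_independent M T (\<Union>i\<in>I. C i) (\<Union>j\<in>J. D j)"
proof -
  define E where "E n k = C (fst k) \<inter> (T ^^ n) -` D (snd k)" for n k
  have "E n k \<in> sets M" if "k \<in> I \<times> J" for n k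
    using that sets by (auto simp: E_def intro: sets_Int_vimage_funpow)
  moreover have "disjoint_family_on (E n) (I \<times> J)" for n
    unfolding disjoint_family_on_def
  proof (intro ballI impI)
    fix k l assume kl: "k \<in> I \<times> J" "l \<in> I \<times> J" "k \<noteq> l"
    then have "C (fst k) \<inter> C (fst l) = {} \<or> D (snd k) \<inter> D (snd l) = {}"
      using disj unfolding disjoint_family_on_def by (metis mem_Times_iff prod_eq_iff)
    then show "E n k \<inter> E n l = {}"
      by (auto simp: E_def)
  qed
  ultimately have "measure M (\<Union>k\<in>I \<times> J. E n k) = (\<Sum>k\<in>I \<times> J. measure M (E n k))" for n
    using assms(1,2) by (intro finite_measure_finite_Union) auto
  moreover have "(\<Union>i\<in>I. C i) \<inter> (T ^^ n) -` (\<Union>j\<in>J. D j) = (\<Union>k\<in>I \<times> J. E n k)" for n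
    by (auto simp: E_def)
  moreover have "measure M (\<Union>i\<in>I. C i) = (\<Sum>i\<in>I. measure M (C i))"
    "measure M (\<Union>j\<in>J. D j) = (\<Sum>j\<in>J. measure M (D j))"
    using assms(1,2) disj sets by (auto intro!: finite_measure_finite_Union)
  then have "measure M (\<Union>i\<in>I. C i) * measure M (\<Union>j\<in>J. D j)
      = (\<Sum>k\<in>I \<times> J. measure M (C (fst k)) * measure M (D (snd k)))"
    by (simp only: sum_product sum.cartesian_product case_prod_unfold)
  moreover have "cesaro_tendsto (\<lambda>n. \<Sum>k\<in>I \<times> J. measure M (E n k))
      (\<Sum>k\<in>I \<times> J. measure M (C (fst k)) * measure M (D (snd k)))"
    using indep by (intro cesaro_tendsto_sum) (auto simp: cesaro_independent_def E_def)
  ultimately show ?thesis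
    by (simp add: cesaro_independent_def)
qed

lemma cesaro_independent_generator_right:
  assumes gen: "Int_stable A" "A \<subseteq> Pow (space M)" "sets M = sigma_sets (space M) A"
    and basic: "\<And>D. D \<in> A \<Longrightarrow> cesaro_independent M T C D"
    and C: "C \<in> sets M" and D: "D \<in> sets M"
  shows "cesaro_independent M T C D"
proof -
  define N where "N n = distr (density M (indicator C)) M (T ^^ n)" for n
  have N: "measure (N n) E = measure M (C \<inter> (T ^^ n) -` E)" if "E \<in> sets M" for n E
  proof -
    have "C \<inter> ((T ^^ n) -` E \<inter> space M) = C \<inter> (T ^^ n) -` E"
      using sets.sets_into_space[OF C] by auto
    then show ?thesis
      using measurable_sets[OF measurable_funpow that] measurable_funpow that C
      by (simp add: N_def measure_distr measure_restricted)
  qed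
  have "cesaro_tendsto (\<lambda>n. measure (N n) D) (measure M C * measure M D)"
  proof (rule cesaro_tendsto_measure_generator[OF finite_measure_axioms _ _ _ gen _ _ D])
    show "finite_measure (N n)" for n
      unfolding N_def using measurable_funpow
      by (intro finite_measure.finite_measure_distr finite_measure_restricted C) simp
    show "measure (N n) E \<le> measure M E" if "E \<in> sets M" for n E
    proof -
      have "measure (N n) E \<le> measure M ((T ^^ n) -` E \<inter> space M)"
        unfolding N[OF that] using sets.sets_into_space[OF C] measurable_sets[OF measurable_funpow that]
        by (intro finite_measure_mono) auto
      then show ?thesis
        by (simp add: measure_vimage_funpow[OF that])
    qed
    have "C \<inter> (T ^^ n) -` space M = C" for n
      using sets.sets_into_space[OF C] funpow_in_space by auto
    then show "cesaro_tendsto (\<lambda>n. measure (N n) (space M)) (measure M C * measure M (space M))"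
      by (simp add: N prob_space cesaro_tendsto_const)
    show "cesaro_tendsto (\<lambda>n. measure (N n) D) (measure M C * measure M D)" if "D \<in> A" for D
      using basic[OF that] that gen by (simp add: N cesaro_independent_def)
  qed (simp add: N_def)
  then show ?thesis
    by (simp add: N D cesaro_independent_def)
qed

lemma cesaro_independent_generator_left:
  assumes gen: "Int_stable A" "A \<subseteq> Pow (space M)" "sets M = sigma_sets (space M) A"
    and basic: "\<And>C. C \<in> A \<Longrightarrow> cesaro_independent M T C D"
    and C: "C \<in> sets M" and D: "D \<in> sets M"
  shows "cesaro_independent M T C D"
proof -
  define N where "N n = density M (indicator ((T ^^ n) -` D \<inter> space M))" for n
  have vimage_D: "(T ^^ n) -` D \<inter> space M \<in> sets M" for n
    using measurable_funpow D by (rule measurable_sets)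
  have N: "measure (N n) E = measure M (E \<inter> (T ^^ n) -` D)" if "E \<in> sets M" for n E
  proof -
    have "(T ^^ n) -` D \<inter> space M \<inter> E = E \<inter> (T ^^ n) -` D"
      using sets.sets_into_space[OF that] by auto
    then show ?thesis
      using measure_restricted[OF vimage_D that] by (simp add: N_def)
  qed
  have "cesaro_tendsto (\<lambda>n. measure (N n) C) (measure M D * measure M C)"
  proof (rule cesaro_tendsto_measure_generator[OF finite_measure_axioms _ _ _ gen _ _ C])
    show "finite_measure (N n)" for n
      unfolding N_def by (intro finite_measure_restricted vimage_D)
    show "measure (N n) E \<le> measure M E" if "E \<in> sets M" for n E
      unfolding N[OF that] by (intro finite_measure_mono that) simp
    show "cesaro_tendsto (\<lambda>n. measure (N n) (space M)) (measure M D * measure M (space M))"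
      using measure_vimage_funpow[OF D] by (simp add: N prob_space cesaro_tendsto_const Int_commute)
    show "cesaro_tendsto (\<lambda>n. measure (N n) C) (measure M D * measure M C)" if "C \<in> A" for C
      using basic[OF that] that gen by (simp add: N cesaro_independent_def mult.commute)
  qed (simp add: N_def)
  then show ?thesis
    by (simp add: N C cesaro_independent_def mult.commute)
qed

lemma cesaro_independent_generator:
  assumes gen: "Int_stable A" "A \<subseteq> Pow (space M)" "sets M = sigma_sets (space M) A"
    and basic: "\<And>C D. C \<in> A \<Longrightarrow> D \<in> A \<Longrightarrow> cesaro_independent M T C D"
    and C: "C \<in> sets M" and D: "D \<in> sets M"
  shows "cesaro_independent M T C D"
proof (rule cesaro_independent_generator_left[OF gen _ C D])
  fix C assume "C \<in> A"
  then show "cesaro_independent M T C D"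
    using gen by (intro cesaro_independent_generator_right[OF gen basic _ D]) auto
qed

lemma cesaro_independent_imp_ergodic:
  assumes "\<And>B. B \<in> sets M \<Longrightarrow> cesaro_independent M T B B"
  shows "ergodic M T"
  unfolding ergodic_def
proof (intro conjI prob_space_axioms invariant ballI impI)
  fix B assume B: "B \<in> sets M" and inv: "T -` B \<inter> space M = B"
  have "(T ^^ n) z \<in> B" if "z \<in> B" for n z
    using that inv by (induction n) auto
  then have "B \<inter> (T ^^ n) -` B = B" for n
    by auto
  then have "measure M B = measure M B * measure M B"
    using assms[OF B] unfolding cesaro_independent_def
    by (intro cesaro_tendsto_unique[OF cesaro_tendsto_const]) simp
  then show "measure M B = 0 \<or> measure M B = 1"
    by simp
qed

end

section \<open>Markov partitions\<close>

text \<open>The assumption \<open>markov_cells\<close> is the Markov property with denominators cleared: given the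
  current cell, the cells visited later are independent of the previous one.\<close>

locale irreducible_markov_partition = probability_preserving M T
  for M :: "'b measure" and T :: "'b \<Rightarrow> 'b" +
  fixes Q :: "'q set" and C :: "'q \<Rightarrow> 'b set"
  assumes finite_cells: "finite Q"
    and sets_cell: "q \<in> Q \<Longrightarrow> C q \<in> sets M"
    and cell_positive: "q \<in> Q \<Longrightarrow> 0 < measure M (C q)"
    and disjoint_cells: "disjoint_family_on C Q"
    and cells_cover: "(\<Union>q\<in>Q. C q) = space M"
    and markov_cells: "q \<in> Q \<Longrightarrow> q' \<in> Q \<Longrightarrow> q'' \<in> Q \<Longrightarrow>
      measure M (C q \<inter> T -` (C q' \<inter> (T ^^ n) -` C q'')) * measure M (C q')
        = measure M (C q \<inter> T -` C q') * measure M (C q' \<inter> (T ^^ n) -` C q'')"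
    and irreducible_cells: "q \<in> Q \<Longrightarrow> q' \<in> Q \<Longrightarrow> \<exists>n. 0 < measure M (C q \<inter> (T ^^ n) -` C q')"
begin

definition transition :: "'q \<Rightarrow> 'q \<Rightarrow> real" where
  "transition q q' = measure M (C q \<inter> T -` C q') / measure M (C q)"

lemma cell_subset_space: "q \<in> Q \<Longrightarrow> C q \<subseteq> space M"
  using cells_cover by blast

lemma sets_cell_Int_vimage: "q \<in> Q \<Longrightarrow> E \<in> sets M \<Longrightarrow> C q \<inter> T -` E \<in> sets M"
  using sets_Int_vimage_funpow[of "C q" E 1] by (simp add: sets_cell)

lemma measure_eq_sum_cells: "E \<in> sets M \<Longrightarrow> measure M E = (\<Sum>q\<in>Q. measure M (C q \<inter> E))"
  using finite_cells disjoint_cells sets_cell cells_cover sets.sets_into_space[of E M]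
  by (intro measure_eq_sum_Int) simp_all

lemma measure_cell_Int_vimage:
  assumes q: "q \<in> Q" and E: "\<And>t. t \<in> Q \<Longrightarrow> C t \<inter> E \<in> sets M"
  shows "measure M (C q \<inter> T -` E) = (\<Sum>t\<in>Q. measure M (C q \<inter> T -` (C t \<inter> E)))"
proof -
  have split: "T -` C t \<inter> (C q \<inter> T -` E) = C q \<inter> T -` (C t \<inter> E)" for t
    by blast
  have "measure M (C q \<inter> T -` E) = (\<Sum>t\<in>Q. measure M (T -` C t \<inter> (C q \<inter> T -` E)))"
  proof (rule measure_eq_sum_Int)
    show "disjoint_family_on (\<lambda>t. T -` C t) Q"
      using disjoint_cells by (auto simp: disjoint_family_on_def)
    show "T -` C t \<inter> (C q \<inter> T -` E) \<in> sets M" if "t \<in> Q" for t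
      unfolding split by (intro sets_cell_Int_vimage q E that)
    show "C q \<inter> T -` E \<subseteq> (\<Union>t\<in>Q. T -` C t)"
      using cell_subset_space[OF q] in_space cells_cover by blast
  qed (rule finite_cells)
  then show ?thesis
    by (simp only: split)
qed

lemma measure_cell_Int_vimage_Suc:
  assumes "q \<in> Q" "q' \<in> Q"
  shows "measure M (C q \<inter> (T ^^ Suc n) -` C q')
    = (\<Sum>t\<in>Q. measure M (C q \<inter> T -` (C t \<inter> (T ^^ n) -` C q')))"
proof -
  have "(T ^^ Suc n) -` C q' = T -` ((T ^^ n) -` C q')"
    by (auto simp: funpow_Suc_right simp del: funpow.simps)
  then show ?thesis
    using measure_cell_Int_vimage[OF assms(1), of "(T ^^ n) -` C q'"] assms(2)
    by (simp only: sets_Int_vimage_funpow sets_cell)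
qed

lemma transition_positive_intermediate:
  assumes q: "q \<in> Q" "q' \<in> Q" and positive: "0 < measure M (C q \<inter> (T ^^ Suc n) -` C q')"
  shows "\<exists>t\<in>Q. 0 < transition q t \<and> 0 < measure M (C t \<inter> (T ^^ n) -` C q')"
proof -
  define E where "E t = C t \<inter> (T ^^ n) -` C q'" for t
  have sets_E: "E t \<in> sets M" if "t \<in> Q" for t
    using that q by (simp add: E_def sets_Int_vimage_funpow sets_cell)
  have "(\<Sum>t\<in>Q. measure M (C q \<inter> T -` E t)) \<noteq> 0"
    using positive unfolding measure_cell_Int_vimage_Suc[OF q] E_def by simp
  then obtain t where t: "t \<in> Q" and "measure M (C q \<inter> T -` E t) \<noteq> 0"
    by (rule sum.not_neutral_contains_not_neutral)
  then have positive_t: "0 < measure M (C q \<inter> T -` E t)"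
    by (simp add: zero_less_measure_iff)
  also have "\<dots> \<le> measure M (C q \<inter> T -` C t)"
    using q t by (intro finite_measure_mono sets_cell_Int_vimage sets_cell) (auto simp: E_def)
  finally have "0 < transition q t"
    using cell_positive[OF q(1)] by (simp add: transition_def)
  moreover have "measure M (C q \<inter> T -` E t) \<le> measure M (T -` E t \<inter> space M)"
    using cell_subset_space[OF q(1)] measurable_sets[OF measurable_funpow[of 1] sets_E[OF t]]
    by (intro finite_measure_mono) auto
  then have "0 < measure M (E t)"
    using positive_t measure_vimage[OF sets_E[OF t]] by simp
  ultimately show ?thesis
    using t by (auto simp: E_def)
qed

lemma transition_positive_path:
  assumes "q \<in> Q" "q' \<in> Q" "0 < measure M (C q \<inter> (T ^^ n) -` C q')"
  shows "(q, q') \<in> {(s, t). s \<in> Q \<and> t \<in> Q \<and> 0 < transition s t}\<^sup>*"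
  using assms
proof (induction n arbitrary: q)
  case 0
  then have "C q \<inter> C q' \<noteq> {}"
    by auto
  then have "q = q'"
    using disjoint_cells 0 by (auto simp: disjoint_family_on_def)
  then show ?case
    by simp
next
  case (Suc n)
  then obtain t where t: "t \<in> Q" "0 < transition q t" "0 < measure M (C t \<inter> (T ^^ n) -` C q')"
    using transition_positive_intermediate by blast
  then have "(t, q') \<in> {(s, t). s \<in> Q \<and> t \<in> Q \<and> 0 < transition s t}\<^sup>*"
    using Suc by blast
  then show ?case
    using Suc.prems(1) t by (intro converse_rtrancl_into_rtrancl[of q t]) simp_all
qed

sublocale chain: irreducible_markov_chain Q transition
proof
  show "(\<Sum>q'\<in>Q. transition q q') = 1" if q: "q \<in> Q" for q
    using measure_cell_Int_vimage[OF q, of UNIV] cell_positive[OF q]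
    by (simp add: transition_def sets_cell flip: sum_divide_distrib)
  show "(q, q') \<in> {(s, t). s \<in> Q \<and> t \<in> Q \<and> 0 < transition s t}\<^sup>*" if "q \<in> Q" "q' \<in> Q" for q q'
    using irreducible_cells[OF that] transition_positive_path[OF that] by blast
qed (simp_all add: finite_cells transition_def)

lemma cesaro_independent_cells:
  assumes q: "q \<in> Q" and q': "q' \<in> Q"
  shows "cesaro_independent M T (C q) (C q')"
proof -
  define f where "f n s = measure M (C s \<inter> (T ^^ n) -` C q') / measure M (C s)" for n s
  have "cesaro_tendsto (\<lambda>n. f n q) (measure M (C q'))"
  proof (rule chain.cesaro_tendsto_conserved_average)
    show "f (Suc n) s = (\<Sum>t\<in>Q. transition s t * f n t)" if s: "s \<in> Q" for n s
    proof -
      have "measure M (C s \<inter> T -` (C t \<inter> (T ^^ n) -` C q')) = measure M (C s \<inter> T -` C t) * f n t"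
        if t: "t \<in> Q" for t
        using markov_cells[OF s t q', of n] cell_positive[OF t] by (simp add: f_def eq_divide_eq)
      then show ?thesis
        unfolding f_def[of "Suc n"] measure_cell_Int_vimage_Suc[OF s q']
        by (simp add: transition_def sum_divide_distrib)
    qed
    show "\<bar>f n s\<bar> \<le> 1" if "s \<in> Q" for n s
      using cell_positive[OF that] finite_measure_mono[OF Int_lower1 sets_cell[OF that]]
      by (simp add: f_def)
    show "(\<Sum>s\<in>Q. measure M (C s)) = 1"
      using measure_eq_sum_cells[OF sets.top] cell_subset_space by (simp add: prob_space Int_absorb2)
    have "measure M (C s) * f n s = measure M (C s \<inter> ((T ^^ n) -` C q' \<inter> space M))"
      if "s \<in> Q" for n s
    proof -
      have "C s \<inter> ((T ^^ n) -` C q' \<inter> space M) = C s \<inter> (T ^^ n) -` C q'"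
        using cell_subset_space[OF that] by blast
      then show ?thesis
        using cell_positive[OF that] by (simp add: f_def)
    qed
    then show "(\<Sum>s\<in>Q. measure M (C s) * f n s) = measure M (C q')" for n
      using measure_eq_sum_cells[OF measurable_sets[OF measurable_funpow sets_cell[OF q']]]
        measure_vimage_funpow[OF sets_cell[OF q']] by simp
  qed (rule q)
  then have "cesaro_tendsto (\<lambda>n. measure M (C q) * f n q) (measure M (C q) * measure M (C q'))"
    by (rule cesaro_tendsto_cmult)
  then show ?thesis
    using cell_positive[OF q] by (simp add: cesaro_independent_def f_def)
qed

end

section \<open>Invariant measures on the full shift\<close>

lemma length_factor [simp]: "length (factor x i j) = nat (j - i)"
  by (simp add: factor_def)

lemma nth_factor: "k < nat (j - i) \<Longrightarrow> factor x i j ! k = x (i + int k)"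
  by (simp add: factor_def)

lemma factor_eq_iff: "factor y i j = factor x i j \<longleftrightarrow> (\<forall>n\<in>{i..<j}. y n = x n)"
  by (auto simp: factor_def)

lemma factor_append:
  assumes "i \<le> j" "j \<le> k"
  shows "factor x i j @ factor x j k = factor x i k"
  using assms upto_split1[of i j "k - 1"] by (cases "j = k") (simp_all add: factor_def)

lemma factor_Cons: "i < j \<Longrightarrow> factor x i j = x i # factor x (i + 1) j"
  by (simp add: factor_def upto_rec1)

lemma factor_snoc: "i \<le> j \<Longrightarrow> factor x i (j + 1) = factor x i j @ [x j]"
  by (simp add: factor_def upto_rec2)

lemma take_factor:
  assumes "i \<le> j" "j \<le> k"
  shows "take (nat (j - i)) (factor x i k) = factor x i j"
  using factor_append[OF assms, of x, symmetric] by simp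

lemma drop_factor:
  assumes "i \<le> j" "j \<le> k"
  shows "drop (nat (j - i)) (factor x i k) = factor x j k"
  using factor_append[OF assms, of x, symmetric] by simp

lemma funpow_shift_map: "(shift_map ^^ n) x = (\<lambda>k. x (k + int n))"
  by (induction n) (auto simp: shift_map_def add_ac)

lemma factor_funpow_shift_map: "factor ((shift_map ^^ n) x) i j = factor x (i + int n) (j + int n)"
  by (rule nth_equalityI) (simp_all add: nth_factor funpow_shift_map algebra_simps)

lemma factor_shift_map: "factor (shift_map x) i j = factor x (i + 1) (j + 1)"
  using factor_funpow_shift_map[of 1] by simp

lemma in_language: "x \<in> X \<Longrightarrow> i \<le> j \<Longrightarrow> factor x i j \<in> language X"
  by (auto simp: language_def)

lemma finite_words: "finite {w :: 'a::finite list. length w = n}"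
  using finite_lists_length_eq[of "UNIV :: 'a set" n] by simp

lemma openin_factor_cylinder:
  "openin (product_topology (\<lambda>_. discrete_topology UNIV) UNIV) {y. factor y i j = factor x i j}"
proof -
  have "{y. factor y i j = factor x i j} = (\<Pi>\<^sub>E n\<in>UNIV. if n \<in> {i..<j} then {x n} else UNIV)"
    by (auto simp: factor_eq_iff PiE_UNIV_domain Pi_iff split: if_splits)
  moreover have "finite {n. (if n \<in> {i..<j} then {x n} else UNIV) \<noteq> UNIV}"
    by (rule finite_subset[of _ "{i..<j}"]) auto
  ultimately show ?thesis
    by (auto simp: openin_PiE_gen)
qed

lemma open_contains_factor_cylinder:
  fixes x :: "int \<Rightarrow> 'b"
  assumes "openin (product_topology (\<lambda>_. discrete_topology UNIV) UNIV) U" "x \<in> U"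
  shows "\<exists>k::nat. {y. factor y (- int k) (int k) = factor x (- int k) (int k)} \<subseteq> U"
proof -
  obtain V where V: "finite {n. V n \<noteq> (UNIV :: 'b set)}" "x \<in> Pi\<^sub>E UNIV V" "Pi\<^sub>E UNIV V \<subseteq> U"
    using assms by (auto simp: openin_product_topology_alt)
  obtain k where k: "\<And>n. V n \<noteq> UNIV \<Longrightarrow> nat \<bar>n\<bar> < k"
    using finite_nat_set_iff_bounded[of "(\<lambda>n. nat \<bar>n\<bar>) ` {n. V n \<noteq> UNIV}"] V(1) by auto
  have "y \<in> U" if y: "factor y (- int k) (int k) = factor x (- int k) (int k)" for y
  proof -
    have "y n \<in> V n" for n
    proof (cases "V n = UNIV")
      case False
      then have "y n = x n"
        using k[of n] y unfolding factor_eq_iff by (elim bspec) auto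
      then show ?thesis
        using V(2) by (auto simp: PiE_UNIV_domain)
    qed simp
    then show ?thesis
      using V(3) by (auto simp: PiE_UNIV_domain)
  qed
  then show ?thesis
    by blast
qed

locale shift_measure = probability_preserving \<mu> shift_map for \<mu> :: "(int \<Rightarrow> 'a::finite) measure" +
  assumes sets_eq: "sets \<mu> = sets full_shift"
begin

definition word_prob :: "'a list \<Rightarrow> real" where
  "word_prob w = measure \<mu> {x. factor x 0 (int (length w)) = w}"

lemma space_eq [simp]: "space \<mu> = UNIV"
  using sets_eq_imp_space_eq[OF sets_eq] by (simp add: space_PiM PiE_UNIV_domain)

lemma sets_letter: "{x. x n = a} \<in> sets \<mu>"
proof -
  have "(\<lambda>x. x n) -` {a} \<inter> space full_shift \<in> sets full_shift"
    by (rule measurable_sets[OF measurable_component_singleton]) auto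
  then show ?thesis
    by (simp add: sets_eq space_PiM PiE_UNIV_domain vimage_def)
qed

lemma sets_factor: "{x. R (factor x i j)} \<in> sets \<mu>"
proof -
  have "(\<lambda>x. factor x i j) \<in> measurable \<mu> (count_space UNIV)"
  proof -
    have "{x. factor x i j = w} \<in> sets \<mu>" for w
    proof -
      have "{x. factor x i j = w}
          = (if length w = nat (j - i) then \<Inter>k\<in>{..<length w}. {x. x (i + int k) = w ! k} else {})"
        by (auto simp: list_eq_iff_nth_eq nth_factor)
      also have "\<dots> \<in> sets \<mu>"
        using sets.top[of \<mu>] sets_letter by (auto intro!: sets.countable_INT'')
      finally show ?thesis .
    qed
    then show ?thesis
      by (simp add: measurable_count_space_eq2_countable vimage_def)
  qed
  then show ?thesis
    using measurable_sets[of "\<lambda>x. factor x i j" \<mu> "count_space UNIV" "Collect R"]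
    by (simp add: vimage_def)
qed

lemma measurable_coordinates:
  assumes "\<And>i A. {z \<in> space N. f z i \<in> A} \<in> sets N"
  shows "f \<in> measurable N \<mu>"
proof -
  have "f \<in> measurable N full_shift"
    using assms by (intro measurable_PiM_single) auto
  then show ?thesis
    by (simp add: measurable_cong_sets[OF refl sets_eq])
qed

lemma measure_factor_translate:
  "measure \<mu> {x. R (factor x i (i + k))} = measure \<mu> {x. R (factor x 0 k)}"
proof -
  have shift: "measure \<mu> {x. R (factor x (i + int n) (j + int n))} = measure \<mu> {x. R (factor x i j)}"
    for i j n
    using measure_vimage_funpow[OF sets_factor[of R i j], of n]
    by (simp add: vimage_def factor_funpow_shift_map)
  show ?thesis
  proof (cases "0 \<le> i")
    case True
    then show ?thesis
      using shift[of 0 "nat i" k] by (simp add: add.commute)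
  next
    case False
    then show ?thesis
      using shift[of i "nat (- i)" "i + k"] by simp
  qed
qed

lemma measure_factor_eq:
  assumes "length w = nat (j - i)"
  shows "measure \<mu> {x. factor x i j = w} = word_prob w"
proof -
  have "factor x 0 (int (length w)) = factor x 0 (j - i)" for x :: "int \<Rightarrow> 'a"
    using assms by (simp add: factor_def)
  then show ?thesis
    using measure_factor_translate[of "\<lambda>v. v = w" i "j - i"] by (simp add: word_prob_def)
qed

lemma measure_factor_letter_eq:
  assumes "i \<le> j" "length w = nat (j - i)"
  shows "measure \<mu> {x. x j = a \<and> factor x i j = w} = word_prob (w @ [a])"
proof -
  have "{x. x j = a \<and> factor x i j = w} = {x. factor x i (j + 1) = w @ [a]}"
    using assms by (auto simp: factor_snoc)
  then show ?thesis
    using measure_factor_eq[of "w @ [a]" "j + 1" i] assms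
    by (simp add: nat_add_distrib flip: diff_add_eq)
qed

lemma measure_prefix_in:
  assumes V: "V \<subseteq> {w. length w = n}"
  shows "measure \<mu> {x. factor x 0 (int n) \<in> V} = (\<Sum>w\<in>V. word_prob w)"
proof -
  have "{x. factor x 0 (int n) \<in> V} = (\<Union>w\<in>V. {x. factor x 0 (int n) = w})"
    by auto
  also have "measure \<mu> \<dots> = (\<Sum>w\<in>V. measure \<mu> {x. factor x 0 (int n) = w})"
    using finite_subset[OF V finite_words] sets_factor
    by (intro finite_measure_finite_Union) (auto simp: disjoint_family_on_def)
  also have "\<dots> = (\<Sum>w\<in>V. word_prob w)"
    using V by (intro sum.cong) (auto simp: word_prob_def)
  finally show ?thesis .
qed

lemma word_prob_nonneg: "0 \<le> word_prob w"
  by (simp add: word_prob_def)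

lemma word_prob_append_le: "word_prob (u @ v) \<le> word_prob u" "word_prob (u @ v) \<le> word_prob v"
proof -
  let ?m = "int (length u)" and ?n = "int (length u) + int (length v)"
  have iff: "factor x 0 ?n = u @ v \<longleftrightarrow> factor x 0 ?m = u \<and> factor x ?m ?n = v"
    for x :: "int \<Rightarrow> 'a"
    using factor_append[of 0 ?m ?n x, symmetric] by simp
  show "word_prob (u @ v) \<le> word_prob u"
    unfolding word_prob_def by (intro finite_measure_mono sets_factor) (auto simp: iff)
  have "word_prob (u @ v) \<le> measure \<mu> {x. factor x ?m ?n = v}"
    unfolding word_prob_def by (intro finite_measure_mono sets_factor) (auto simp: iff)
  then show "word_prob (u @ v) \<le> word_prob v"
    by (simp add: measure_factor_eq)
qed

lemma word_prob_append_eq_0: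
  "word_prob u = 0 \<Longrightarrow> word_prob (u @ v) = 0"
  "word_prob v = 0 \<Longrightarrow> word_prob (u @ v) = 0"
  using word_prob_append_le[of u v] word_prob_nonneg[of "u @ v"] by simp_all

lemma measure_support_eq: "measure_support \<mu> = {x. \<forall>i j. 0 < word_prob (factor x i j)}"
proof (intro equalityI subsetI CollectI allI)
  fix x i j
  assume x: "x \<in> measure_support \<mu>"
  have "0 < emeasure \<mu> {y. factor y i j = factor x i j}"
    using x openin_factor_cylinder[of i j x] by (auto simp: measure_support_def)
  then show "0 < word_prob (factor x i j)"
    by (simp add: emeasure_eq_measure measure_factor_eq)
next
  fix x
  assume x: "x \<in> {x. \<forall>i j. 0 < word_prob (factor x i j)}"
  have "0 < emeasure \<mu> U"
    if U: "openin (product_topology (\<lambda>_. discrete_topology UNIV) UNIV) U" "x \<in> U" for U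
  proof -
    let ?cyl = "\<lambda>k w. {y. factor y (- int k) (int k) = w}"
    have "U = (\<Union>k. {y. ?cyl k (factor y (- int k) (int k)) \<subseteq> U})"
      using open_contains_factor_cylinder[OF U(1)] by blast
    also have "\<dots> \<in> sets \<mu>"
      by (intro sets.countable_UN image_subsetI sets_factor)
    finally have "U \<in> sets \<mu>" .
    moreover obtain k where "?cyl k (factor x (- int k) (int k)) \<subseteq> U"
      using open_contains_factor_cylinder[OF U] by blast
    ultimately have "measure \<mu> (?cyl k (factor x (- int k) (int k))) \<le> measure \<mu> U"
      by (intro finite_measure_mono)
    then have "word_prob (factor x (- int k) (int k)) \<le> measure \<mu> U"
      by (subst (asm) measure_factor_eq) simp_all
    then show ?thesis
      using x by (auto simp: emeasure_eq_measure intro: less_le_trans)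
  qed
  then show "x \<in> measure_support \<mu>"
    by (auto simp: measure_support_def)
qed

lemma sets_measure_support: "measure_support \<mu> \<in> sets \<mu>"
proof -
  have "measure_support \<mu> = (\<Inter>i. \<Inter>j. {x. 0 < word_prob (factor x i j)})"
    by (auto simp: measure_support_eq)
  also have "\<dots> \<in> sets \<mu>"
    by (intro sets.countable_INT image_subsetI sets_factor) auto
  finally show ?thesis .
qed

lemma AE_in_measure_support: "AE x in \<mu>. x \<in> measure_support \<mu>"
proof -
  have "AE x in \<mu>. 0 < word_prob (factor x i j)" for i j
  proof -
    have "AE x in \<mu>. factor x i j \<noteq> w" if w: "word_prob w = 0" for w
    proof (cases "length w = nat (j - i)")
      case True
      then show ?thesis
        using w sets_factor[of "\<lambda>v. v = w" i j]
        by (simp add: AE_iff_measurable[OF _ refl] emeasure_eq_measure measure_factor_eq)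
    qed auto
    then have "AE x in \<mu>. \<forall>w\<in>{w. word_prob w = 0}. factor x i j \<noteq> w"
      by (subst AE_ball_countable) auto
    then show ?thesis
      by eventually_elim (use word_prob_nonneg in \<open>auto simp: less_le\<close>)
  qed
  then show ?thesis
    by (simp add: measure_support_eq AE_all_countable)
qed

lemma measure_Int_support:
  assumes "E \<in> sets \<mu>"
  shows "measure \<mu> {x \<in> measure_support \<mu>. x \<in> E} = measure \<mu> E"
  unfolding Collect_conj_eq Collect_mem_eq using AE_in_measure_support sets_measure_support assms
  by (intro measure_eq_AE) auto

lemma shift_map_in_support_iff: "shift_map x \<in> measure_support \<mu> \<longleftrightarrow> x \<in> measure_support \<mu>"
proof -
  have "(\<forall>i j. 0 < word_prob (factor x (i + 1) (j + 1))) \<longleftrightarrow> (\<forall>i j. 0 < word_prob (factor x i j))"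
    by (metis diff_add_cancel)
  then show ?thesis
    by (simp add: measure_support_eq factor_shift_map)
qed

lemma in_language_support_iff: "w \<in> language (measure_support \<mu>) \<longleftrightarrow> 0 < word_prob w"
proof
  assume "0 < word_prob w"
  then have "measure \<mu> {x \<in> measure_support \<mu>. x \<in> {x. factor x 0 (int (length w)) = w}} \<noteq> 0"
    by (subst measure_Int_support) (auto simp: word_prob_def intro: sets_factor)
  then have "{x \<in> measure_support \<mu>. x \<in> {x. factor x 0 (int (length w)) = w}} \<noteq> {}"
    by (metis measure_empty)
  then obtain x where "x \<in> measure_support \<mu>" "factor x 0 (int (length w)) = w"
    by blast
  then show "w \<in> language (measure_support \<mu>)"
    using in_language[of x "measure_support \<mu>" 0 "int (length w)"] by simp
qed (auto simp: language_def measure_support_eq)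

lemma language_support_suffix:
  assumes "u @ v \<in> language (measure_support \<mu>)"
  shows "v \<in> language (measure_support \<mu>)"
  using assms word_prob_append_le(2)[of u v] by (simp add: in_language_support_iff)

end

locale markov_shift = shift_measure \<mu> for \<mu> :: "(int \<Rightarrow> 'a::finite) measure" +
  fixes r :: nat
  assumes markov: "markov_measure r \<mu>"
begin

lemma word_prob_snoc_ratio:
  assumes "r \<le> length w" "word_prob w \<noteq> 0"
  defines "s \<equiv> drop (length w - r) w"
  shows "word_prob (w @ [a]) / word_prob w = word_prob (s @ [a]) / word_prob s"
proof -
  let ?m = "length w"
  have "measure \<mu> {x. factor x 0 (int ?m) = w} \<noteq> 0"
    using assms by (simp add: measure_factor_eq)
  then have "\<P>(x in \<mu>. x (int ?m) = a \<bar> factor x 0 (int ?m) = w) =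
      \<P>(x in \<mu>. x (int ?m) = a \<bar> factor x (int ?m - int r) (int ?m) = s)"
    using markov assms unfolding markov_measure_def by auto
  then show ?thesis
    using assms(1) by (simp add: cond_prob_def measure_factor_eq measure_factor_letter_eq s_def)
qed

lemma word_prob_markov_snoc:
  assumes "r \<le> length s"
  shows "word_prob (y @ s @ [a]) * word_prob s = word_prob (y @ s) * word_prob (s @ [a])"
proof (cases "word_prob (y @ s) = 0")
  case True
  then show ?thesis
    using word_prob_append_eq_0(1)[of "y @ s" "[a]"] by simp
next
  case False
  then have "word_prob s \<noteq> 0"
    using word_prob_append_eq_0(2) by blast
  then have "word_prob (y @ s @ [a]) / word_prob (y @ s) = word_prob (s @ [a]) / word_prob s"
    using word_prob_snoc_ratio[of "y @ s" a] word_prob_snoc_ratio[of s a] False assms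
    by simp
  then show ?thesis
    using False \<open>word_prob s \<noteq> 0\<close> by (simp add: field_simps)
qed

lemma word_prob_markov_append:
  assumes "r \<le> length s"
  shows "word_prob (y @ s @ v) * word_prob s = word_prob (y @ s) * word_prob (s @ v)"
proof (induction v rule: rev_induct)
  case Nil
  show ?case
    by simp
next
  case (snoc a v)
  show ?case
  proof (cases "word_prob (s @ v) = 0")
    case True
    then have "word_prob (s @ v @ [a]) = 0"
      using word_prob_append_eq_0(1)[of "s @ v" "[a]"] by simp
    moreover from this have "word_prob (y @ s @ v @ [a]) = 0"
      by (rule word_prob_append_eq_0(2))
    ultimately show ?thesis
      by simp
  next
    case False
    have "word_prob (y @ s @ v @ [a]) * word_prob s * word_prob (s @ v)
        = word_prob (y @ s @ v) * word_prob s * word_prob (s @ v @ [a])"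
      using word_prob_markov_snoc[of "s @ v" y a] assms by simp
    also have "\<dots> = word_prob (y @ s) * word_prob (s @ v @ [a]) * word_prob (s @ v)"
      by (simp add: snoc.IH)
    finally show ?thesis
      using False by simp
  qed
qed

lemma language_support_overlap:
  assumes "r \<le> length s" "y @ s \<in> language (measure_support \<mu>)" "s @ v \<in> language (measure_support \<mu>)"
  shows "y @ s @ v \<in> language (measure_support \<mu>)"
proof -
  have "word_prob (y @ s @ v) * word_prob s \<noteq> 0"
    unfolding word_prob_markov_append[OF assms(1)] using assms(2,3)
    by (simp add: in_language_support_iff)
  then show ?thesis
    using word_prob_nonneg[of "y @ s @ v"] by (simp add: in_language_support_iff less_le)
qed

end

section \<open>Skew products\<close>

lemma (in group) card_vimage_right_mult:
  assumes "h \<in> carrier G" "A \<subseteq> carrier G"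
  shows "card {g \<in> carrier G. g \<otimes> h \<in> A} = card A"
proof -
  have "bij_betw (\<lambda>g. g \<otimes> h) {g \<in> carrier G. g \<otimes> h \<in> A} A"
    using assms by (intro bij_betw_byWitness[where f' = "\<lambda>g. g \<otimes> inv h"]) (auto simp: m_assoc subset_eq)
  then show ?thesis
    by (rule bij_betw_same_card)
qed

locale skew_product = shift_measure \<mu> + group G
  for \<mu> :: "(int \<Rightarrow> 'a::finite) measure" and G :: "('g, 'b) monoid_scheme" (structure) +
  fixes \<phi> :: "'a list \<Rightarrow> 'g"
  assumes finite_carrier: "finite (carrier G)"
    and phi_hom: "\<phi> \<in> hom word_monoid G"
begin

abbreviation S :: "(int \<Rightarrow> 'a) set" where "S \<equiv> measure_support \<mu>"
abbreviation M :: "('g \<times> (int \<Rightarrow> 'a)) measure" where "M \<equiv> skew_measure G \<mu>"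
abbreviation T :: "'g \<times> (int \<Rightarrow> 'a) \<Rightarrow> 'g \<times> (int \<Rightarrow> 'a)" where "T \<equiv> skew_map G \<phi>"

lemma phi_closed [simp]: "\<phi> w \<in> carrier G"
  using phi_hom by (auto simp: hom_def word_monoid_def)

lemma phi_append: "\<phi> (u @ v) = \<phi> u \<otimes> \<phi> v"
  using phi_hom by (auto simp: hom_def word_monoid_def)

lemma phi_Nil [simp]: "\<phi> [] = \<one>"
  using phi_append[of "[]" "[]"] by simp

lemma card_carrier_pos: "0 < card (carrier G)"
  using finite_carrier one_closed by (auto simp: card_gt_0_iff)

lemma sets_support_Collect: "{x. R x} \<in> sets \<mu> \<Longrightarrow> {x \<in> S. R x} \<in> sets \<mu>"
  using sets_measure_support by (simp add: Collect_conj_eq)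

lemma prob_space_support: "prob_space (restrict_space \<mu> S)"
  using AE_in_measure_support sets_measure_support
  by (intro prob_space_restrict_space) (simp_all add: emeasure_eq_1_AE)

sublocale product: pair_prob_space "uniform_count_measure (carrier G)" "restrict_space \<mu> S"
proof -
  interpret U: prob_space "uniform_count_measure (carrier G)"
    using finite_carrier by (intro prob_space_uniform_count_measure) auto
  interpret R: prob_space "restrict_space \<mu> S"
    by (rule prob_space_support)
  show "pair_prob_space (uniform_count_measure (carrier G)) (restrict_space \<mu> S)" ..
qed

lemma prob_space_M: "prob_space M"
  unfolding skew_measure_def by (rule product.prob_space_axioms)

lemma space_M: "space M = carrier G \<times> S"
  by (simp add: skew_measure_def space_pair_measure space_uniform_count_measure space_restrict_space)

lemma sets_Times_M: "A \<subseteq> carrier G \<Longrightarrow> B \<in> sets \<mu> \<Longrightarrow> B \<subseteq> S \<Longrightarrow> A \<times> B \<in> sets M"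
  unfolding skew_measure_def using sets_measure_support
  by (intro pair_measureI) (auto simp: sets_uniform_count_measure sets_restrict_space_iff)

lemma emeasure_Times_M:
  assumes "A \<subseteq> carrier G" "B \<in> sets \<mu>" "B \<subseteq> S"
  shows "emeasure M (A \<times> B)
    = emeasure (uniform_count_measure (carrier G)) A * emeasure (restrict_space \<mu> S) B"
  unfolding skew_measure_def using assms sets_measure_support
  by (intro product.M2.emeasure_pair_measure_Times)
     (auto simp: sets_uniform_count_measure sets_restrict_space_iff)

lemma measure_Times_M:
  assumes "A \<subseteq> carrier G" "B \<in> sets \<mu>" "B \<subseteq> S"
  shows "measure M (A \<times> B) = real (card A) / real (card (carrier G)) * measure \<mu> B"
proof -
  have "measure M (A \<times> B)
      = measure (uniform_count_measure (carrier G)) A * measure (restrict_space \<mu> S) B"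
    using emeasure_Times_M[OF assms] by (simp add: measure_def enn2real_mult)
  then show ?thesis
    using assms finite_carrier sets_measure_support
    by (simp add: measure_uniform_count_measure measure_restrict_space)
qed

lemma sets_M_Collect_factor: "{(g, x). g \<in> carrier G \<and> x \<in> S \<and> R g (factor x i j)} \<in> sets M"
proof -
  have "{(g, x). g \<in> carrier G \<and> x \<in> S \<and> R g (factor x i j)}
      = (\<Union>g\<in>carrier G. {g} \<times> {x \<in> S. R g (factor x i j)})"
    by auto
  also have "\<dots> \<in> sets M"
    using finite_carrier by (intro sets.finite_UN sets_Times_M sets_support_Collect sets_factor) auto
  finally show ?thesis .
qed

lemma measurable_Pair_M:
  assumes f: "f \<in> measurable N (count_space (carrier G))"
    and h: "h \<in> measurable N \<mu>" "h \<in> space N \<rightarrow> S"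
  shows "(\<lambda>z. (f z, h z)) \<in> measurable N M"
  unfolding skew_measure_def
proof (rule measurable_Pair)
  show "f \<in> measurable N (uniform_count_measure (carrier G))"
    using f by (simp add: measurable_cong_sets[OF refl sets_uniform_count_measure_count_space])
  show "h \<in> measurable N (restrict_space \<mu> S)"
    using h by (intro measurable_restrict_space2) auto
qed

lemma measurable_T: "T \<in> measurable M M"
proof -
  let ?R = "restrict_space \<mu> S"
  have sets: "sets (count_space (carrier G) \<Otimes>\<^sub>M ?R) = sets M"
    unfolding skew_measure_def
    by (intro sets_pair_measure_cong sets_uniform_count_measure_count_space[symmetric] refl)
  have "(\<lambda>x. T (g, x)) \<in> measurable ?R M" if g: "g \<in> carrier G" for g
  proof -
    have "(\<lambda>x. x 0) \<in> measurable \<mu> (count_space UNIV)"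
      by (simp add: measurable_count_space_eq2_countable vimage_def sets_letter)
    then have "(\<lambda>x. g \<otimes> \<phi> [x 0]) \<in> measurable \<mu> (count_space (carrier G))"
      by (rule measurable_compose) (use g in simp)
    moreover have "shift_map \<in> measurable \<mu> \<mu>"
      using measurable_funpow[of 1] by simp
    ultimately show ?thesis
      unfolding skew_map_def prod.case
      by (intro measurable_Pair_M measurable_restrict_space1)
         (auto simp: space_restrict_space shift_map_in_support_iff)
  qed
  then have "T \<in> measurable (count_space (carrier G) \<Otimes>\<^sub>M ?R) M"
    using finite_carrier by (intro measurable_pair_measure_countable1) (auto intro: countable_finite)
  then show ?thesis
    by (simp only: measurable_cong_sets[OF sets refl])
qed

lemma measure_vimage_T_Times:
  assumes A: "A \<subseteq> carrier G" and B: "B \<in> sets \<mu>" "B \<subseteq> S"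
  shows "measure M (T -` (A \<times> B) \<inter> space M) = measure M (A \<times> B)"
proof -
  interpret M: prob_space M
    by (rule prob_space_M)
  define E where "E a = {x. x 0 = a \<and> shift_map x \<in> B}" for a
  have vimage_B: "{x. shift_map x \<in> B} \<in> sets \<mu>"
    using measurable_sets[OF measurable_funpow[of 1] B(1)] by (simp add: vimage_def)
  have E: "E a \<in> sets \<mu>" "E a \<subseteq> S" for a
    using sets.Int[OF sets_letter[of 0 a] vimage_B] B(2) shift_map_in_support_iff
    by (auto simp: E_def Collect_conj_eq)
  define A' where "A' a = {g \<in> carrier G. g \<otimes> \<phi> [a] \<in> A}" for a
  have A': "A' a \<subseteq> carrier G" "card (A' a) = card A" for a
    using card_vimage_right_mult[OF phi_closed A] by (auto simp: A'_def)
  have "T -` (A \<times> B) \<inter> space M = (\<Union>a. A' a \<times> E a)"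
    using E(2) by (auto simp: A'_def E_def space_M skew_map_def)
  also have "measure M \<dots> = (\<Sum>a\<in>UNIV. measure M (A' a \<times> E a))"
    using A' E
    by (intro M.finite_measure_finite_Union) (auto simp: disjoint_family_on_def E_def sets_Times_M)
  also have "\<dots> = real (card A) / real (card (carrier G)) * (\<Sum>a\<in>UNIV. measure \<mu> (E a))"
    using A' E by (simp add: measure_Times_M sum_distrib_left)
  also have "(\<Sum>a\<in>UNIV. measure \<mu> (E a)) = measure \<mu> (\<Union>a. E a)"
    using E by (intro finite_measure_finite_Union[symmetric]) (auto simp: disjoint_family_on_def E_def)
  also have "(\<Union>a. E a) = {x. shift_map x \<in> B}"
    by (auto simp: E_def)
  also have "measure \<mu> \<dots> = measure \<mu> B"
    using measure_vimage[OF B(1)] by (simp add: vimage_def)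
  finally show ?thesis
    by (simp add: measure_Times_M A B)
qed

lemma invariant_T: "invariant_under M T"
proof -
  interpret M: prob_space M
    by (rule prob_space_M)
  have "uniform_count_measure (carrier G) \<Otimes>\<^sub>M restrict_space \<mu> S = distr M M T"
  proof (rule pair_measure_eqI)
    fix A B
    assume "A \<in> sets (uniform_count_measure (carrier G))" "B \<in> sets (restrict_space \<mu> S)"
    then have AB: "A \<subseteq> carrier G" "B \<in> sets \<mu>" "B \<subseteq> S"
      using sets_measure_support by (auto simp: sets_uniform_count_measure sets_restrict_space_iff)
    then have "emeasure (distr M M T) (A \<times> B) = emeasure M (A \<times> B)"
      by (simp add: emeasure_distr measurable_T sets_Times_M M.emeasure_eq_measure
          measure_vimage_T_Times)
    then show "emeasure (uniform_count_measure (carrier G)) A * emeasure (restrict_space \<mu> S) B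
        = emeasure (distr M M T) (A \<times> B)"
      using emeasure_Times_M[OF AB] by simp
  qed (simp_all add: skew_measure_def product.M1.sigma_finite_measure_axioms
      product.M2.sigma_finite_measure_axioms)
  then show ?thesis
    using measurable_T by (simp add: invariant_under_def skew_measure_def)
qed

sublocale skew: probability_preserving M T
  using prob_space_M invariant_T
  by (intro probability_preserving.intro probability_preserving_axioms.intro)

lemma funpow_T:
  assumes "g \<in> carrier G"
  shows "(T ^^ n) (g, x) = (g \<otimes> \<phi> (factor x 0 (int n)), (shift_map ^^ n) x)"
proof (induction n)
  case 0
  then show ?case
    using assms by (simp add: factor_def)
next
  case (Suc n)
  have "factor x 0 (int (Suc n)) = factor x 0 (int n) @ [x (int n)]"
    using factor_snoc[of 0 "int n" x] by (simp add: add.commute)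
  moreover have "(T ^^ Suc n) (g, x) = T (g \<otimes> \<phi> (factor x 0 (int n)), (shift_map ^^ n) x)"
    by (simp add: Suc)
  ultimately show ?case
    using assms by (simp add: skew_map_def phi_append m_assoc funpow_shift_map[of n])
qed

lemma funpow_shift_map_in_support: "x \<in> S \<Longrightarrow> (shift_map ^^ n) x \<in> S"
  by (induction n) (simp_all add: shift_map_in_support_iff)

definition cylinder :: "nat \<Rightarrow> 'g \<Rightarrow> 'a list set \<Rightarrow> ('g \<times> (int \<Rightarrow> 'a)) set" where
  "cylinder n g V = {g} \<times> {x \<in> S. factor x 0 (int n) \<in> V}"

lemma sets_cylinder: "g \<in> carrier G \<Longrightarrow> cylinder n g V \<in> sets M"
  unfolding cylinder_def by (intro sets_Times_M sets_support_Collect sets_factor) auto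

lemma measure_cylinder:
  assumes "g \<in> carrier G" "V \<subseteq> {w. length w = n}"
  shows "measure M (cylinder n g V) = (\<Sum>w\<in>V. word_prob w) / real (card (carrier G))"
  using measure_Times_M[of "{g}" "{x \<in> S. factor x 0 (int n) \<in> V}"] assms(1)
    measure_Int_support[OF sets_factor[of "\<lambda>w. w \<in> V" 0 "int n"]]
    sets_support_Collect[OF sets_factor[of "\<lambda>w. w \<in> V" 0 "int n"]]
  by (simp add: cylinder_def measure_prefix_in[OF assms(2)])

lemma cylinder_Cons_Int_vimage:
  assumes g: "g \<in> carrier G" and m: "length s \<le> m"
  shows "cylinder (Suc (length s)) g {a # s} \<inter> T -` cylinder m h V
    = (if h = g \<otimes> \<phi> [a] then cylinder (Suc m) g ((#) a ` {w \<in> V. take (length s) w = s}) else {})"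
proof -
  have Cons: "factor x 0 (int (Suc k)) = x 0 # factor (shift_map x) 0 (int k)" for x :: "int \<Rightarrow> 'a" and k
    using factor_Cons[of 0 "int (Suc k)" x] by (simp add: factor_shift_map add.commute)
  have take: "factor (shift_map x) 0 (int (length s)) = take (length s) (factor (shift_map x) 0 (int m))"
    for x :: "int \<Rightarrow> 'a"
    using take_factor[of 0 "int (length s)" "int m" "shift_map x", symmetric] m by simp
  show ?thesis
    by (auto simp: cylinder_def skew_map_def Cons take shift_map_in_support_iff simp del: of_nat_Suc)
qed

lemma cylinder_Int_vimage_funpow:
  assumes h: "h \<in> carrier G"
  shows "cylinder n h {t} \<inter> (T ^^ m) -` cylinder n k {u}
    = cylinder (m + n) h {w. length w = m + n \<and> take n w = t \<and> h \<otimes> \<phi> (take m w) = k \<and> drop m w = u}"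
proof -
  have "take n (factor x 0 (int (m + n))) = factor x 0 (int n)"
    "take m (factor x 0 (int (m + n))) = factor x 0 (int m)"
    "drop m (factor x 0 (int (m + n))) = factor ((shift_map ^^ m) x) 0 (int n)" for x :: "int \<Rightarrow> 'a"
    using take_factor[of 0 "int n" "int (m + n)" x] take_factor[of 0 "int m" "int (m + n)" x]
      drop_factor[of 0 "int m" "int (m + n)" x] by (simp_all add: factor_funpow_shift_map add.commute)
  then show ?thesis
    using h by (auto simp: cylinder_def funpow_T funpow_shift_map_in_support simp del: of_nat_add)
qed

definition window :: "nat \<Rightarrow> ('g \<times> 'a list) set \<Rightarrow> ('g \<times> (int \<Rightarrow> 'a)) set" where
  "window k W = {(g, x). g \<in> carrier G \<and> x \<in> S \<and> (g, factor x (- int k) (int k)) \<in> W}"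

abbreviation windows :: "('g \<times> (int \<Rightarrow> 'a)) set set" where
  "windows \<equiv> {window k W | k W. True}"

lemma sets_window: "window k W \<in> sets M"
  unfolding window_def by (rule sets_M_Collect_factor)

lemma window_subset_space: "window k W \<subseteq> space M"
  using sets.sets_into_space[OF sets_window] .

lemma window_mono:
  assumes "k \<le> l"
  shows "\<exists>W'. window k W = window l W'"
proof -
  have "factor x (- int k) (int k) = take (2 * k) (drop (l - k) (factor x (- int l) (int l)))"
    for x :: "int \<Rightarrow> 'a"
    using assms drop_factor[of "- int l" "- int k" "int l" x] take_factor[of "- int k" "int k" "int l" x]
    by (simp add: nat_mult_distrib nat_minus_as_int)
  then have "window k W = window l {(g, w). (g, take (2 * k) (drop (l - k) w)) \<in> W}"
    by (simp add: window_def)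
  then show ?thesis ..
qed

lemma Int_stable_windows: "Int_stable windows"
proof (rule Int_stableI)
  fix C D
  assume "C \<in> windows" "D \<in> windows"
  then obtain k V l W where "C = window k V" "D = window l W"
    by auto
  then obtain V' W' where "C = window (max k l) V'" "D = window (max k l) W'"
    using window_mono[of k "max k l" V] window_mono[of l "max k l" W] by auto
  then have "C \<inter> D = window (max k l) (V' \<inter> W')"
    by (auto simp: window_def)
  then show "C \<inter> D \<in> windows"
    by blast
qed

lemma sets_M_generated_by_windows: "sets M = sigma_sets (space M) windows"
proof (rule antisym)
  show "sigma_sets (space M) windows \<subseteq> sets M"
    by (rule sets.sigma_sets_subset) (auto simp: sets_window)
  define \<Sigma> where "\<Sigma> = sigma (space M) windows"
  have windows_subset: "windows \<subseteq> Pow (space M)"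
    using window_subset_space by blast
  then have space_\<Sigma>: "space \<Sigma> = carrier G \<times> S" and window: "window k W \<in> sets \<Sigma>" for k W
    by (auto simp: \<Sigma>_def space_M)
  have "fst -` {g} \<inter> space \<Sigma> = window 0 ({g} \<times> UNIV)" for g
    by (auto simp: space_\<Sigma> window_def)
  then have "fst \<in> measurable \<Sigma> (count_space (carrier G))"
    using finite_carrier window by (auto simp: measurable_count_space_eq2 space_\<Sigma>)
  moreover have "{z \<in> space \<Sigma>. snd z i \<in> A} \<in> sets \<Sigma>" for i A
  proof -
    define k where "k = Suc (nat \<bar>i\<bar>)"
    have "factor x (- int k) (int k) ! nat (i + int k) = x i" for x :: "int \<Rightarrow> 'a"
      by (subst nth_factor) (auto simp: k_def)
    then have "{z \<in> space \<Sigma>. snd z i \<in> A} = window k {(g, w). w ! nat (i + int k) \<in> A}"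
      by (auto simp: space_\<Sigma> window_def)
    then show ?thesis
      using window by simp
  qed
  ultimately have id: "(\<lambda>z. (fst z, snd z)) \<in> measurable \<Sigma> M"
    by (intro measurable_Pair_M measurable_coordinates) (auto simp: space_\<Sigma>)
  have "E \<in> sets \<Sigma>" if "E \<in> sets M" for E
    using measurable_sets[OF id that] sets.sets_into_space[OF that]
    by (simp add: space_M space_\<Sigma> vimage_def Int_absorb2)
  then show "sets M \<subseteq> sigma_sets (space M) windows"
    using windows_subset by (auto simp: \<Sigma>_def)
qed

end

locale irreducible_skew_product = skew_product \<mu> G \<phi> + markov_shift \<mu> r
  for \<mu> :: "(int \<Rightarrow> 'a::finite) measure" and r :: nat
    and G :: "('g, 'b) monoid_scheme" (structure) and \<phi> :: "'a list \<Rightarrow> 'g" +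
  assumes letters_occur: "\<forall>a. \<exists>x\<in>measure_support \<mu>. \<exists>n. x n = a"
    and phi_epi: "\<phi> \<in> epi word_monoid G"
    and irreducible: "morphism_irreducible G \<phi> (measure_support \<mu>)"
begin

lemma letter_extension: "\<exists>u. length u = n \<and> a # u \<in> language S"
proof -
  obtain x k where "x \<in> S" "x k = a"
    using letters_occur by blast
  then have "a # factor x (k + 1) (k + 1 + int n) \<in> language S"
    using in_language[of x S k "k + 1 + int n"] by (simp add: factor_Cons)
  then show ?thesis
    by (intro exI[of _ "factor x (k + 1) (k + 1 + int n)"]) simp
qed

text \<open>Irreducibility only controls the value \<open>\<one>\<close>. Applied to the last \<open>r\<close> letters of a word
  it leaves the image of the remaining prefix unchanged, and the Markov property lets us glue;
  so each letter can be appended to the image.\<close>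

lemma irreducible_all_values:
  assumes s: "s \<in> language S" and "t \<in> language S" "k \<in> carrier G"
  shows "\<exists>w. s @ w @ t \<in> language S \<and> \<phi> (s @ w) = k"
proof -
  have irred: "\<exists>w. u @ w @ v \<in> language S \<and> \<phi> (u @ w) = \<one>"
    if "u \<in> language S" "v \<in> language S" for u v
    using irreducible that by (simp add: morphism_irreducible_def)
  have "\<exists>w. s @ w @ t \<in> language S \<and> \<phi> (s @ w) = \<phi> z" if "t \<in> language S" for z t
    using that
  proof (induction z arbitrary: t rule: rev_induct)
    case Nil
    then show ?case
      using irred[OF s] by simp
  next
    case (snoc a z)
    obtain u where u: "length u = r" "a # u \<in> language S"
      using letter_extension by blast
    obtain w where w: "s @ w @ a # u \<in> language S" "\<phi> (s @ w) = \<phi> z"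
      using snoc.IH[OF u(2)] by blast
    have "u \<in> language S"
      using language_support_suffix[of "[a]" u] u(2) by simp
    then obtain w' where w': "u @ w' @ t \<in> language S" "\<phi> (u @ w') = \<one>"
      using irred snoc.prems by blast
    have "(s @ w @ [a]) @ u @ w' @ t \<in> language S"
      using u w w' language_support_overlap[of u "s @ w @ [a]" "w' @ t"] by simp
    moreover have "\<phi> ((s @ w) @ [a] @ u @ w') = \<phi> (z @ [a])"
      by (simp only: phi_append[of "s @ w"] phi_append[of "[a]"] phi_append[of z] w(2) w'(2)
          r_one phi_closed)
    ultimately show ?case
      by (intro exI[of _ "w @ [a] @ u @ w'"]) simp
  qed
  moreover obtain z where "\<phi> z = k"
    using phi_epi assms(3) by (force simp: epi_def word_monoid_def)
  ultimately show ?thesis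
    using assms(2) by blast
qed

definition states :: "nat \<Rightarrow> ('g \<times> 'a list) set" where
  "states n = carrier G \<times> {u \<in> language S. length u = n}"

abbreviation cell :: "nat \<Rightarrow> 'g \<times> 'a list \<Rightarrow> ('g \<times> (int \<Rightarrow> 'a)) set" where
  "cell n q \<equiv> cylinder n (fst q) {snd q}"

lemma finite_states: "finite (states n)"
  unfolding states_def
  by (intro finite_cartesian_product finite_carrier finite_subset[OF _ finite_words[of n]]) auto

lemma sets_cell: "q \<in> states n \<Longrightarrow> cell n q \<in> sets M"
  by (auto simp: states_def sets_cylinder)

lemma measure_cell: "q \<in> states n \<Longrightarrow> measure M (cell n q) = word_prob (snd q) / real (card (carrier G))"
  by (auto simp: states_def measure_cylinder)

lemma measure_cell_positive: "q \<in> states n \<Longrightarrow> 0 < measure M (cell n q)"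
  using card_carrier_pos by (auto simp: measure_cell states_def simp flip: in_language_support_iff)

lemma disjoint_cells: "disjoint_family_on (cell n) (states n)"
  by (auto simp: disjoint_family_on_def cylinder_def prod_eq_iff)

lemma UN_cells:
  "(\<Union>q\<in>{q \<in> states n. R q}. cell n q) = {z \<in> space M. R (fst z, factor (snd z) 0 (int n))}"
proof (intro equalityI subsetI)
  fix z assume "z \<in> {z \<in> space M. R (fst z, factor (snd z) 0 (int n))}"
  then show "z \<in> (\<Union>q\<in>{q \<in> states n. R q}. cell n q)"
    by (intro UN_I[of "(fst z, factor (snd z) 0 (int n))"])
       (auto simp: states_def cylinder_def space_M in_language)
qed (auto simp: states_def cylinder_def space_M)

lemma cells_cover: "(\<Union>q\<in>states n. cell n q) = space M"
  using UN_cells[of n "\<lambda>_. True"] by simp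

lemma measure_cylinder_Cons:
  assumes g: "g \<in> carrier G" "h \<in> carrier G" and r: "r \<le> length t"
    and V: "V \<subseteq> {w. length w = k \<and> take (length t) w = t}"
  shows "measure M (cylinder (Suc k) g ((#) a ` V)) * word_prob t
    = word_prob (a # t) * measure M (cylinder k h V)"
proof -
  have "word_prob (a # w) * word_prob t = word_prob (a # t) * word_prob w" if "w \<in> V" for w
    using word_prob_markov_append[OF r, of "[a]" "drop (length t) w"] that V
      append_take_drop_id[of "length t" w] by (auto simp: subset_eq)
  then have "(\<Sum>w\<in>V. word_prob (a # w)) * word_prob t = word_prob (a # t) * (\<Sum>w\<in>V. word_prob w)"
    by (simp add: sum_distrib_left sum_distrib_right)
  moreover have "measure M (cylinder k h V) = (\<Sum>w\<in>V. word_prob w) / real (card (carrier G))"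
    using V by (intro measure_cylinder g) auto
  moreover have "measure M (cylinder (Suc k) g ((#) a ` V))
      = (\<Sum>w\<in>V. word_prob (a # w)) / real (card (carrier G))"
    using V g(1) by (subst measure_cylinder) (auto simp: sum.reindex comp_def)
  ultimately show ?thesis
    by simp
qed

lemma markov_cells:
  assumes n: "r \<le> n" "0 < n" and q: "q \<in> states n" "q' \<in> states n"
  shows "measure M (cell n q \<inter> T -` (cell n q' \<inter> (T ^^ m) -` cell n q'')) * measure M (cell n q')
    = measure M (cell n q \<inter> T -` cell n q') * measure M (cell n q' \<inter> (T ^^ m) -` cell n q'')"
proof -
  obtain g a s h t where q_def: "q = (g, a # s)" "q' = (h, t)"
    and g: "g \<in> carrier G" "h \<in> carrier G" and length: "Suc (length s) = n" "length t = n"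
    using q n by (cases "snd q") (auto simp: states_def)
  define V where "V = {w. length w = m + n \<and> take n w = t \<and>
    h \<otimes> \<phi> (take m w) = fst q'' \<and> drop m w = snd q''}"
  have future: "cell n q' \<inter> (T ^^ m) -` cell n q'' = cylinder (m + n) h V"
    using cylinder_Int_vimage_funpow[OF g(2), of n t m "fst q''" "snd q''"] by (simp add: q_def V_def)
  have step: "cell n q \<inter> T -` cylinder k h U
      = (if h = g \<otimes> \<phi> [a] then cylinder (Suc k) g ((#) a ` {w \<in> U. take (length s) w = s}) else {})"
    if "n \<le> k" for k U
    using cylinder_Cons_Int_vimage[OF g(1), of s k a h U] that length by (simp add: q_def)
  have take: "take (length s) w = take (length s) t" if "take n w = t" for w
    using that length by (metis take_take min.absorb1 le_SucI le_refl)
  show ?thesis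
  proof (cases "h = g \<otimes> \<phi> [a] \<and> take (length s) t = s")
    case False
    then have "cell n q \<inter> T -` cylinder (m + n) h V = {}" "cell n q \<inter> T -` cell n q' = {}"
      using step[of "m + n" V] step[of n "{t}"] take by (auto simp: q_def V_def cylinder_def)
    then show ?thesis
      unfolding future by simp
  next
    case True
    have "{w \<in> V. take (length s) w = s} = V" "{w \<in> {t}. take (length s) w = s} = {t}"
      using True take by (auto simp: V_def)
    then have vimage: "cell n q \<inter> T -` cylinder (m + n) h V = cylinder (Suc (m + n)) g ((#) a ` V)"
      "cell n q \<inter> T -` cell n q' = cylinder (Suc n) g {a # t}"
      using step[of "m + n" V] step[of n "{t}"] True by (simp_all add: q_def(2))
    have "measure M (cylinder (Suc (m + n)) g ((#) a ` V)) * word_prob t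
        = word_prob (a # t) * measure M (cylinder (m + n) h V)"
      using n length by (intro measure_cylinder_Cons g) (auto simp: V_def)
    then show ?thesis
      unfolding future vimage using g length by (simp add: measure_cylinder q_def(2))
  qed
qed

lemma cells_communicate:
  assumes "q \<in> states n" "q' \<in> states n"
  shows "\<exists>m. 0 < measure M (cell n q \<inter> (T ^^ m) -` cell n q')"
proof -
  obtain g s h t where q: "q = (g, s)" "g \<in> carrier G" "s \<in> language S" "length s = n"
    and q': "q' = (h, t)" "h \<in> carrier G" "t \<in> language S" "length t = n"
    using assms by (auto simp: states_def)
  obtain w where w: "s @ w @ t \<in> language S" "\<phi> (s @ w) = inv g \<otimes> h"
    using irreducible_all_values[of s t "inv g \<otimes> h"] q q' by auto
  define m where "m = length (s @ w)"
  have "g \<otimes> \<phi> (s @ w) = h"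
    using w(2) q(2) q'(2) by (simp flip: m_assoc)
  then have "cell (m + n) (g, s @ w @ t) \<subseteq> cell n q \<inter> (T ^^ m) -` cell n q'"
    unfolding q(1) q'(1) fst_conv snd_conv cylinder_Int_vimage_funpow[OF q(2)]
    using q(4) q'(4) by (auto simp: cylinder_def m_def)
  moreover have "cell n q \<inter> (T ^^ m) -` cell n q' \<in> sets M"
    using q q' by (intro skew.sets_Int_vimage_funpow sets_cylinder) simp_all
  ultimately have "measure M (cell (m + n) (g, s @ w @ t))
      \<le> measure M (cell n q \<inter> (T ^^ m) -` cell n q')"
    by (intro skew.finite_measure_mono)
  moreover have "0 < measure M (cell (m + n) (g, s @ w @ t))"
    using w(1) q(2) q'(4) by (intro measure_cell_positive) (simp add: states_def m_def)
  ultimately show ?thesis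
    by (intro exI[of _ m]) simp
qed

lemma irreducible_markov_partition_cells:
  assumes "r \<le> n" "0 < n"
  shows "irreducible_markov_partition M T (states n) (cell n)"
  by (intro irreducible_markov_partition.intro irreducible_markov_partition_axioms.intro
      skew.probability_preserving_axioms finite_states sets_cell measure_cell_positive disjoint_cells
      cells_cover markov_cells cells_communicate assms)

lemma vimage_funpow_window:
  "(T ^^ k) -` window k W \<inter> space M
    = (\<Union>q\<in>{q \<in> states (2 * k). (fst q \<otimes> \<phi> (take k (snd q)), snd q) \<in> W}. cell (2 * k) q)"
proof -
  have "factor ((shift_map ^^ k) x) (- int k) (int k) = factor x 0 (int (2 * k))"
    "factor x 0 (int k) = take k (factor x 0 (int (2 * k)))" for x :: "int \<Rightarrow> 'a"
    using take_factor[of 0 "int k" "int (2 * k)" x] by (simp_all add: factor_funpow_shift_map)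
  then show ?thesis
    unfolding UN_cells
    by (auto simp: window_def space_M funpow_T funpow_shift_map_in_support simp del: of_nat_mult)
qed

lemma cesaro_independent_windows: "cesaro_independent M T (window k V) (window l W)"
proof -
  define n where "n = Suc (max r (max k l))"
  have n: "k \<le> n" "l \<le> n" "r \<le> 2 * n" "0 < 2 * n"
    by (simp_all add: n_def)
  obtain V' W' where V': "window k V = window n V'" and W': "window l W = window n W'"
    using window_mono[OF n(1), of V] window_mono[OF n(2), of W] by blast
  interpret cells: irreducible_markov_partition M T "states (2 * n)" "cell (2 * n)"
    by (rule irreducible_markov_partition_cells[OF n(3,4)])
  have disjoint: "disjoint_family_on (cell (2 * n)) {q \<in> states (2 * n). R q}" for R
    by (rule disjoint_family_on_mono[OF _ disjoint_cells]) blast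
  have independent: "cesaro_independent M T (\<Union>q\<in>{q \<in> states (2 * n). R q}. cell (2 * n) q)
      (\<Union>q\<in>{q \<in> states (2 * n). R' q}. cell (2 * n) q)" for R R'
    by (rule skew.cesaro_independent_UN[OF _ _ disjoint disjoint])
       (simp_all add: finite_states sets_cell cells.cesaro_independent_cells)
  show ?thesis
    unfolding V' W'
    by (rule skew.cesaro_independent_vimage_funpow[OF sets_window sets_window, of n])
       (simp only: vimage_funpow_window independent)
qed

lemma cesaro_independent_sets:
  assumes "C \<in> sets M" "D \<in> sets M"
  shows "cesaro_independent M T C D"
proof (rule skew.cesaro_independent_generator[OF
      Int_stable_windows _ sets_M_generated_by_windows _ assms])
  show "windows \<subseteq> Pow (space M)"
    using window_subset_space by blast
  show "cesaro_independent M T C D"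
    if "C \<in> windows" "D \<in> windows" for C D
    using that cesaro_independent_windows by blast
qed

theorem ergodic_skew_product: "ergodic M T"
  by (intro skew.cesaro_independent_imp_ergodic cesaro_independent_sets)

theorem language_density:
  assumes K: "K \<subseteq> carrier G"
  shows "has_language_density \<mu> (\<phi> -` K) (real (card K) / real (card (carrier G)))"
proof -
  let ?N = "real (card (carrier G))" and ?E = "\<lambda>n. {x \<in> S. factor x 0 (int n) \<in> \<phi> -` K}"
  have S: "S \<in> sets \<mu>" "measure \<mu> S = 1"
    using sets_measure_support AE_in_measure_support by (simp_all add: prob_eq_1)
  have "measure M (({\<one>} \<times> S) \<inter> (T ^^ n) -` (K \<times> S)) = measure \<mu> (?E n) / ?N" for n
  proof -
    have "({\<one>} \<times> S) \<inter> (T ^^ n) -` (K \<times> S) = {\<one>} \<times> ?E n"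
      by (auto simp: funpow_T funpow_shift_map_in_support)
    then show ?thesis
      using measure_Times_M[of "{\<one>}" "?E n"] sets_support_Collect[OF sets_factor] by auto
  qed
  moreover have "measure M ({\<one>} \<times> S) * measure M (K \<times> S) = 1 / ?N * (real (card K) / ?N)"
    using measure_Times_M[of "{\<one>}" S] measure_Times_M[of K S] S K by simp
  moreover have "cesaro_independent M T ({\<one>} \<times> S) (K \<times> S)"
    using S K by (intro cesaro_independent_sets sets_Times_M) auto
  ultimately have "cesaro_tendsto (\<lambda>n. measure \<mu> (?E n) / ?N) (1 / ?N * (real (card K) / ?N))"
    by (simp add: cesaro_independent_def)
  then have "cesaro_tendsto (\<lambda>n. measure \<mu> (?E n)) (real (card K) / ?N)"
    using cesaro_tendsto_cmult[of "\<lambda>n. measure \<mu> (?E n) / ?N" "1 / ?N * (real (card K) / ?N)" ?N]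
      card_carrier_pos by simp
  then show ?thesis
    by (simp add: cesaro_tendsto_def cesaro_mean_def[abs_def] has_language_density_def)
qed

end

theorem theorem1p2:
  fixes \<mu> :: "(int \<Rightarrow> 'a::finite) measure" and r :: nat
    and X :: "(int \<Rightarrow> 'a) set"
    and G :: "('g, 'b) monoid_scheme" and \<phi> :: "'a list \<Rightarrow> 'g"
  assumes "sets \<mu> = sets full_shift" and "prob_space \<mu>"
    and "invariant_under \<mu> shift_map"
    and "r \<ge> 1" and "markov_measure r \<mu>"
    and "X = measure_support \<mu>"
    and "\<forall>a. \<exists>x\<in>X. \<exists>n. x n = a"
    and "group G" and "finite (carrier G)"
    and "\<phi> \<in> epi word_monoid G" and "\<phi> [] = \<one>\<^bsub>G\<^esub>"
    and "morphism_irreducible G \<phi> X"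
  shows "ergodic (skew_measure G \<mu>) (skew_map G \<phi>) \<and>
    (\<forall>K. K \<subseteq> carrier G \<longrightarrow>
       has_language_density \<mu> (\<phi> -` K) (real (card K) / real (card (carrier G))))"
proof -
  have "\<phi> \<in> hom word_monoid G"
    using \<open>\<phi> \<in> epi word_monoid G\<close> by (simp add: epi_def)
  then interpret irreducible_skew_product \<mu> r G \<phi>
    using assms(1-3,5,7-10,12) unfolding \<open>X = measure_support \<mu>\<close>
    by (intro irreducible_skew_product.intro irreducible_skew_product_axioms.intro
        skew_product.intro skew_product_axioms.intro markov_shift.intro markov_shift_axioms.intro
        shift_measure.intro shift_measure_axioms.intro
        probability_preserving.intro probability_preserving_axioms.intro)
  show ?thesis
    using ergodic_skew_product language_density by blast
qed

end
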